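(* Let $1<\alpha\le 2$, $d,n\in\mathbb{N}$, let $X=\{X(t),t\in\mathbb{R}^d\}$ be an $\alpha$-stable random field of the form $X(t)=\int_E f_t(x)\,M(dx)$, where $M$ is an $\alpha$-stable random measure with control measure $m$ and $\int_E|f_t|^\alpha dm<\infty$ for each $t$, and let $t_1,\dots,t_n\in\mathbb{R}^d$ be distinct locations. Then the Least Scale Linear (LSL) predictor based on $X(t_1),\dots,X(t_n)$ has the following properties. 1. The LSL predictor exists, is unique and exact. 2. If the random field $X$ is stochastically continuous and the random vector $(X(t_1),\dots,X(t_n))^{\mathsf T}$ is full-dimensional, then the LSL predictor is continuous.
   Context: Stable laws: for $1<\alpha\le 2$, $\sigma\ge 0$, $\beta\in[-1,1]$, $\mu\in\mathbb{R}$, $S_\alpha(\sigma,\beta,\mu)$ is the law with characteristic function $\theta\mapsto\exp\{-\sigma^\alpha|\theta|^\alpha(1-i\beta\,\mathrm{sign}(\theta)\tan(\pi\alpha/2))+i\mu\theta\}$; $\sigma$ is its scale parameter, and $\sigma_Z$ denotes the scale parameter of an $\alpha$-stable random variable $Z$. Random measure and integral: let $(E,\mathcal{E},m)$ be a measure space, $\beta:E\to[-1,1]$ measurable, $\mathcal{E}_0=\{A\in\mathcal{E}:m(A)<\infty\}$. An $\alpha$-stable random measure $M$ with control measure $m$ and skewness $\beta$ is an independently scattered (values on disjoint sets are independent), a.s. $\sigma$-additive map from $\mathcal{E}_0$ to random variables with $M(A)\sim S_\alpha\big(m(A)^{1/\alpha},\int_A\beta\,dm/m(A),0\big)$. The integral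 $\int_E f\,dM$ is defined for measurable $f:E\to\mathbb{R}$ with $\int_E|f|^\alpha dm<\infty$ by approximation with simple functions; it is linear, and its scale parameter satisfies $\sigma^\alpha=\int_E|f|^\alpha dm$. LSL predictor: for $t_0\in\mathbb{R}^d$, an LSL predictor of $X(t_0)$ is a random variable $\widehat{X(t_0)}=\sum_{i=1}^n\lambda_iX(t_i)$ whose weights $(\lambda_1,\dots,\lambda_n)\in\mathbb{R}^n$ minimize over $\mathbb{R}^n$ the quantity $$\sigma^\alpha_{\widehat{X(t_0)}-X(t_0)}=\int_E\Big|f_{t_0}(x)-\sum_{i=1}^n\lambda_if_{t_i}(x)\Big|^\alpha m(dx).$$ Existence and uniqueness refer to the random variable $\widehat{X(t_0)}$ (up to almost sure equality), for each $t_0\in\mathbb{R}^d$. Exact: $\widehat{X(t_0)}=X(t_0)$ a.s. whenever $t_0=t_i$ for some $i\in\{1,\dots,n\}$. Continuous: the weights, considered as functions $\lambda_i:\mathbb{R}^d\to\mathbb{R}$, $t\mapsto\lambda_i(t)$, of the prediction location, are continuous (so that $t\mapsto\sum_{i=1}^n\lambda_i(t)X(t_i,\omega)$ is continuous for every $\omega$). Stochastically continuous: $X(s)\to X(t)$ in probability as $s\to t$, for every $t\in\mathbb{R}^d$. Full-dimensional: an $\alpha$-stable random vector in $\mathbb{R}^n$ is full-dimensional if its spectral measure on the unit sphere $\mathbb{S}^{n-1}$ is not concentrated on the intersection of $\mathbb{S}^{n-1}$ with an $(n-1)$-dimensional linear subspace. The spectral measure $\Gamma$ is the finite measure on $\mathbb{S}^{n-1}$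 in the characteristic function representation $\theta\mapsto\exp\{-\int_{\mathbb{S}^{n-1}}|\langle\theta,s\rangle|^\alpha(1-i\,\mathrm{sign}(\langle\theta,s\rangle)\tan\frac{\pi\alpha}{2})\Gamma(ds)+i\langle\theta,\mu\rangle\}$. For $\alpha=2$, full-dimensional means that the covariance matrix is nonsingular. *)

theory Defs
  imports "HOL-Probability.Probability"
begin

definition stable_char :: "real \<Rightarrow> real \<Rightarrow> real \<Rightarrow> real \<Rightarrow> real \<Rightarrow> complex" where
  "stable_char \<alpha> \<sigma> \<beta> \<mu> \<theta> =
     exp (- complex_of_real (\<sigma> powr \<alpha> * \<bar>\<theta>\<bar> powr \<alpha>)
            * (1 - \<i> * complex_of_real (\<beta> * sgn \<theta> * tan (pi * \<alpha> / 2)))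
          + \<i> * complex_of_real (\<mu> * \<theta>))"

definition has_stable_law ::
  "'w measure \<Rightarrow> ('w \<Rightarrow> real) \<Rightarrow> real \<Rightarrow> real \<Rightarrow> real \<Rightarrow> real \<Rightarrow> bool" where
  "has_stable_law P Z \<alpha> \<sigma> \<beta> \<mu> \<longleftrightarrow>
     1 < \<alpha> \<and> \<alpha> \<le> 2 \<and> 0 \<le> \<sigma> \<and> \<beta> \<in> {-1..1} \<and>
     Z \<in> borel_measurable P \<and>
     (\<forall>\<theta>. char (distr P borel Z) \<theta> = stable_char \<alpha> \<sigma> \<beta> \<mu> \<theta>)"

text \<open>
  An \<open>\<alpha>\<close>-stable random measure with control measure \<open>m\<close> and skewness function \<open>\<beta>\<close>. It is a family of
  random variables \<open>M A\<close> indexed by the sets \<open>A\<close> of finite \<open>m\<close>-measure; the values of \<open>M\<close> at all other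
  sets are irrelevant. If \<open>m A = 0\<close>, the skewness parameter below is \<open>0 / 0 = 0\<close>, and the law is the
  point mass at \<open>0\<close> whatever the skewness. The exceptional null set in the \<open>\<sigma>\<close>-additivity may depend
  on the sequence of sets.
\<close>
definition stable_random_measure ::
  "'w measure \<Rightarrow> real \<Rightarrow> 'e measure \<Rightarrow> ('e \<Rightarrow> real) \<Rightarrow> ('e set \<Rightarrow> 'w \<Rightarrow> real) \<Rightarrow> bool" where
  "stable_random_measure P \<alpha> m \<beta> M \<longleftrightarrow>
     \<beta> \<in> borel_measurable m \<and> (\<forall>x\<in>space m. \<beta> x \<in> {-1..1}) \<and>
     (\<forall>A\<in>fmeasurable m.
        has_stable_law P (M A) \<alpha> (measure m A powr (1 / \<alpha>))
          ((LINT x:A|m. \<beta> x) / measure m A) 0) \<and>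
     (\<forall>(A :: nat \<Rightarrow> 'e set) k.
        (\<forall>i<k. A i \<in> fmeasurable m) \<and> disjoint_family_on A {..<k} \<longrightarrow>
        prob_space.indep_vars P (\<lambda>_. borel) (\<lambda>i. M (A i)) {..<k}) \<and>
     (\<forall>A :: nat \<Rightarrow> 'e set.
        (\<forall>i. A i \<in> fmeasurable m) \<and> disjoint_family A \<and> (\<Union>i. A i) \<in> fmeasurable m \<longrightarrow>
        (AE \<omega> in P. (\<lambda>i. M (A i) \<omega>) sums M (\<Union>i. A i) \<omega>))"

definition converges_in_prob ::
  "'w measure \<Rightarrow> ('i \<Rightarrow> 'w \<Rightarrow> real) \<Rightarrow> ('w \<Rightarrow> real) \<Rightarrow> 'i filter \<Rightarrow> bool" where
  "converges_in_prob P Y Z F \<longleftrightarrow>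
     (\<forall>\<epsilon>>0. ((\<lambda>k. measure P {\<omega> \<in> space P. \<bar>Y k \<omega> - Z \<omega>\<bar> > \<epsilon>}) \<longlongrightarrow> 0) F)"

text \<open>
  The integral of a simple function \<open>g\<close> with support of finite measure (\<open>simple_bochner_integrable\<close>),
  written with the level sets of \<open>g\<close>. The value \<open>0\<close>, whose level set may have infinite measure, is left out.
\<close>
definition simple_stable_integral ::
  "'e measure \<Rightarrow> ('e set \<Rightarrow> 'w \<Rightarrow> real) \<Rightarrow> ('e \<Rightarrow> real) \<Rightarrow> 'w \<Rightarrow> real" where
  "simple_stable_integral m M g \<omega> = (\<Sum>y\<in>g ` space m - {0}. y * M {x \<in> space m. g x = y} \<omega>)"

definition stable_integrable :: "real \<Rightarrow> 'e measure \<Rightarrow> ('e \<Rightarrow> real) \<Rightarrow> bool" where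
  "stable_integrable \<alpha> m f \<longleftrightarrow>
     f \<in> borel_measurable m \<and> integrable m (\<lambda>x. \<bar>f x\<bar> powr \<alpha>)"

text \<open>
  \<open>Y\<close> is a version of \<open>\<integral> f dM\<close>: the limit in probability of the integrals of simple functions that
  approximate \<open>f\<close> in \<open>L\<^sup>\<alpha>\<close>. The limit is determined only up to almost sure equality, hence a relation.
\<close>
definition has_stable_integral ::
  "'w measure \<Rightarrow> real \<Rightarrow> 'e measure \<Rightarrow> ('e set \<Rightarrow> 'w \<Rightarrow> real) \<Rightarrow> ('e \<Rightarrow> real) \<Rightarrow> ('w \<Rightarrow> real) \<Rightarrow> bool"
  where
  "has_stable_integral P \<alpha> m M f Y \<longleftrightarrow>
     stable_integrable \<alpha> m f \<and> Y \<in> borel_measurable P \<and>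
     (\<exists>g :: nat \<Rightarrow> 'e \<Rightarrow> real.
        (\<forall>k. Bochner_Integration.simple_bochner_integrable m (g k)) \<and>
        (\<lambda>k. \<integral>x. \<bar>g k x - f x\<bar> powr \<alpha> \<partial>m) \<longlonglongrightarrow> 0 \<and>
        converges_in_prob P (\<lambda>k. simple_stable_integral m M (g k)) Y sequentially)"

definition stochastically_continuous ::
  "'w measure \<Rightarrow> ('a::topological_space \<Rightarrow> 'w \<Rightarrow> real) \<Rightarrow> bool" where
  "stochastically_continuous P X \<longleftrightarrow> (\<forall>t. converges_in_prob P X (X t) (at t))"

definition is_spectral_measure ::
  "'w measure \<Rightarrow> real \<Rightarrow> ('w \<Rightarrow> real ^ 'n) \<Rightarrow> (real ^ 'n) measure \<Rightarrow> bool" where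
  "is_spectral_measure P \<alpha> Y \<Gamma> \<longleftrightarrow>
     finite_measure \<Gamma> \<and> sets \<Gamma> = sets (restrict_space borel (sphere 0 1)) \<and>
     (\<exists>\<mu>. \<forall>\<theta>.
        (CLINT \<omega>|P. iexp (\<theta> \<bullet> Y \<omega>)) =
        exp (- (CLINT s|\<Gamma>. complex_of_real (\<bar>\<theta> \<bullet> s\<bar> powr \<alpha>)
                  * (1 - \<i> * complex_of_real (sgn (\<theta> \<bullet> s) * tan (pi * \<alpha> / 2))))
             + \<i> * complex_of_real (\<theta> \<bullet> \<mu>)))"

definition covariance_matrix :: "'w measure \<Rightarrow> ('w \<Rightarrow> real ^ 'n) \<Rightarrow> real ^ 'n ^ 'n" where
  "covariance_matrix P Y =
     (\<chi> i j. \<integral>\<omega>. (Y \<omega> $ i - (\<integral>\<omega>'. Y \<omega>' $ i \<partial>P)) * (Y \<omega> $ j - (\<integral>\<omega>'. Y \<omega>' $ j \<partial>P)) \<partial>P)"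

text \<open>
  For \<open>1 < \<alpha> < 2\<close> an \<open>\<alpha>\<close>-stable vector has exactly one spectral measure, so the existential quantifier
  only names it. For \<open>\<alpha> = 2\<close> it is not unique, and the covariance matrix is used instead.
\<close>
definition full_dimensional :: "'w measure \<Rightarrow> real \<Rightarrow> ('w \<Rightarrow> real ^ 'n) \<Rightarrow> bool" where
  "full_dimensional P \<alpha> Y \<longleftrightarrow>
     (if \<alpha> = 2 then invertible (covariance_matrix P Y)
      else \<exists>\<Gamma>. is_spectral_measure P \<alpha> Y \<Gamma> \<and>
             \<not> (\<exists>V. subspace V \<and> dim V = CARD('n) - 1 \<and> (AE s in \<Gamma>. s \<in> V)))"

text \<open>
  The quantity \<open>\<sigma>\<^sup>\<alpha>\<close> of the prediction error, for the weights \<open>w\<close> and the prediction location \<open>t0\<close>.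
\<close>
definition error_scale_powr ::
  "real \<Rightarrow> 'e measure \<Rightarrow> ('a \<Rightarrow> 'e \<Rightarrow> real) \<Rightarrow> ('n \<Rightarrow> 'a) \<Rightarrow> 'a \<Rightarrow> real ^ 'n \<Rightarrow> real" where
  "error_scale_powr \<alpha> m f t t0 w =
     (\<integral>x. \<bar>f t0 x - (\<Sum>i\<in>UNIV. w $ i * f (t i) x)\<bar> powr \<alpha> \<partial>m)"

definition is_LSL_weights ::
  "real \<Rightarrow> 'e measure \<Rightarrow> ('a \<Rightarrow> 'e \<Rightarrow> real) \<Rightarrow> ('n \<Rightarrow> 'a) \<Rightarrow> 'a \<Rightarrow> real ^ 'n \<Rightarrow> bool" where
  "is_LSL_weights \<alpha> m f t t0 w \<longleftrightarrow>
     (\<forall>v. error_scale_powr \<alpha> m f t t0 w \<le> error_scale_powr \<alpha> m f t t0 v)"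

definition is_LSL_predictor ::
  "real \<Rightarrow> 'e measure \<Rightarrow> ('a \<Rightarrow> 'e \<Rightarrow> real) \<Rightarrow> ('a \<Rightarrow> 'w \<Rightarrow> real) \<Rightarrow> ('n::finite \<Rightarrow> 'a) \<Rightarrow> 'a
     \<Rightarrow> ('w \<Rightarrow> real) \<Rightarrow> bool" where
  "is_LSL_predictor \<alpha> m f X t t0 Y \<longleftrightarrow>
     (\<exists>w :: real ^ 'n. is_LSL_weights \<alpha> m f t t0 w \<and>
        Y = (\<lambda>\<omega>. \<Sum>i\<in>UNIV. w $ i * X (t i) \<omega>))"

end

theory Submission
  imports Defs
begin

text \<open>
  Everything about the predictor is decided in \<open>L\<^sup>\<alpha>(m)\<close>. The scale of an integral \<open>\<integral> f dM\<close> is the norm of \<open>f\<close>, so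
  an LSL predictor of \<open>X(t0)\<close> is the integral of a best approximation of \<open>f t0\<close> by linear combinations of the
  functions \<open>f (t i)\<close>. Best approximations in a finite-dimensional subspace exist by compactness
  (\<open>residual_scale_attains_min\<close>), even if the functions \<open>f (t i)\<close> are linearly dependent and the weights not
  unique. The best approximation itself is unique because \<open>x \<mapsto> \<bar>x\<bar> powr \<alpha>\<close> is strictly convex for \<open>\<alpha> > 1\<close>
  (\<open>residual_scale_argmin_unique_mod_kernel\<close>), and at \<open>t0 = t i\<close> the error of the best approximation is zero.

  The statements about random variables are connected to \<open>L\<^sup>\<alpha>\<close> through one formula
  (\<open>iexp_stable_integral\<close>): the expectation of \<open>exp (i Y)\<close> for \<open>Y = \<integral> f dM\<close> is \<open>exp (- s (1 - i r tan (pi \<alpha> / 2)))\<close>,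
  where \<open>s = \<integral> \<bar>f\<bar> powr \<alpha> dm\<close> and \<open>r\<close> is some number in \<open>[-1, 1]\<close>. Together with the linearity of the integral
  (\<open>has_stable_integral_linear\<close>) it has three consequences. If \<open>f\<close> is zero in \<open>L\<^sup>\<alpha>\<close>, then \<open>Y = 0\<close> almost surely, which
  transfers uniqueness and exactness from functions to random variables. If \<open>X\<close> is stochastically
  continuous, then \<open>s \<mapsto> f s\<close> is continuous as a map to \<open>L\<^sup>\<alpha>\<close>. If the observed vector is full-dimensional, then
  the functions \<open>f (t i)\<close> are linearly independent.

  Under linear independence the minimising weights are unique. As \<open>t0\<close> varies, the function to be
  minimised varies uniformly in the weights and its minimisers stay bounded, and therefore they depend
  continuously on \<open>t0\<close> (\<open>tendsto_residual_scale_argmin\<close>).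
\<close>

section \<open>The norm of \<open>L\<^sup>\<alpha>\<close>\<close>

text \<open>
  Convexity of \<open>x \<mapsto> x powr a\<close> on the closed half-line. On the open half-line it follows from the sign of the
  second derivative; at the endpoint \<open>0\<close> it amounts to \<open>l powr a \<le> l\<close> for \<open>l \<in> [0, 1]\<close>.
\<close>
lemma powr_convex_combination_le:
  fixes x y l a :: real
  assumes a: "1 < a" and l: "0 \<le> l" "l \<le> 1" and x: "0 \<le> x" and y: "0 \<le> y"
  shows "((1 - l) * x + l * y) powr a \<le> (1 - l) * x powr a + l * y powr a"
proof -
  have t_powr: "s powr a \<le> s" if "0 \<le> s" "s \<le> 1" for s :: real
    using that a powr_mono'[of 1 a s] by simp
  consider "x = 0" | "y = 0" | "0 < x" "0 < y" using x y by fastforce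
  then show ?thesis
  proof cases
    case 1
    then show ?thesis
      using l y t_powr[of l] by (simp add: powr_mult mult_right_mono)
  next
    case 2
    then show ?thesis
      using l x t_powr[of "1 - l"] by (simp add: powr_mult mult_right_mono)
  next
    case 3
    then show ?thesis
      using convex_onD[OF powr_convex[of a], of l x y] a l by simp
  qed
qed

text \<open>
  The derivative of \<open>x \<mapsto> x powr a\<close> is strictly increasing, so by the mean value theorem the increment over the
  right half of \<open>[x, y]\<close> exceeds the increment over the left half. The mean value theorem asks for
  differentiability in the interior only, and so \<open>x = 0\<close> is allowed.
\<close>
lemma powr_midpoint_less:
  fixes x y a :: real
  assumes a: "1 < a" and x: "0 \<le> x" and xy: "x < y"
  shows "((x + y) / 2) powr a < (x powr a + y powr a) / 2"
proof -
  define z where "z = (x + y) / 2"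
  have z: "x < z" "z < y" using xy by (auto simp: z_def)
  have cont: "continuous_on {u..v} (\<lambda>s. s powr a)" if "0 \<le> u" for u v :: real
    using that a by (intro continuous_on_powr' continuous_intros) auto
  have der: "((\<lambda>s. s powr a) has_real_derivative a * s powr (a - 1)) (at s)" if "0 < s" for s :: real
    using that by (auto intro!: derivative_eq_intros)
  have mvt: "\<exists>p. u < p \<and> p < v \<and> v powr a - u powr a = (v - u) * (a * p powr (a - 1))"
    if uv: "0 \<le> u" "u < v" for u v :: real
  proof -
    have "\<exists>D p. u < p \<and> p < v \<and> ((\<lambda>s. s powr a) has_real_derivative D) (at p) \<and>
        v powr a - u powr a = (v - u) * D"
    proof (intro MVT cont uv)
      show "(\<lambda>s. s powr a) differentiable at s" if "u < s" "s < v" for s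
        using der[of s] that uv by (auto simp: real_differentiable_def)
    qed
    then obtain D p where p: "u < p" "p < v" "((\<lambda>s. s powr a) has_real_derivative D) (at p)"
      and eq: "v powr a - u powr a = (v - u) * D" by blast
    have "D = a * p powr (a - 1)" using DERIV_unique[OF p(3) der] p(1) uv by simp
    then show ?thesis using p eq by blast
  qed
  obtain p where p: "x < p" "p < z" and zp: "z powr a - x powr a = (z - x) * (a * p powr (a - 1))"
    using mvt[of x z] x z by auto
  obtain q where q: "z < q" "q < y" and yq: "y powr a - z powr a = (y - z) * (a * q powr (a - 1))"
    using mvt[of z y] x z by auto
  have "p powr (a - 1) < q powr (a - 1)"
    using p q x a by (intro powr_less_mono2) auto
  moreover have eq: "y - z = z - x" by (simp add: z_def field_simps)
  ultimately have "z powr a - x powr a < y powr a - z powr a"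
    unfolding zp yq eq using a z by simp
  then show ?thesis by (simp add: z_def field_simps)
qed

lemma abs_powr_midpoint_le:
  fixes u v a :: real
  assumes a: "1 < a"
  shows "\<bar>(u + v) / 2\<bar> powr a \<le> (\<bar>u\<bar> powr a + \<bar>v\<bar> powr a) / 2"
proof -
  have "\<bar>(u + v) / 2\<bar> powr a \<le> ((1 - 1/2) * \<bar>u\<bar> + 1/2 * \<bar>v\<bar>) powr a"
    using a by (intro powr_mono2) auto
  also have "\<dots> \<le> (1 - 1/2) * \<bar>u\<bar> powr a + 1/2 * \<bar>v\<bar> powr a"
    by (intro powr_convex_combination_le a) auto
  finally show ?thesis by simp
qed

text \<open>
  If \<open>\<bar>u\<bar> \<noteq> \<bar>v\<bar>\<close>, strictness comes from strict convexity on the half-line; if \<open>u = - v \<noteq> 0\<close>, the left-hand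
  side is \<open>0\<close>. This pointwise strictness is the source of the uniqueness of the predictor.
\<close>
lemma abs_powr_midpoint_less:
  fixes u v a :: real
  assumes a: "1 < a" and uv: "u \<noteq> v"
  shows "\<bar>(u + v) / 2\<bar> powr a < (\<bar>u\<bar> powr a + \<bar>v\<bar> powr a) / 2"
proof (cases "\<bar>u\<bar> = \<bar>v\<bar>")
  case True
  with uv have "u = - v" "v \<noteq> 0" by (auto simp: abs_if split: if_splits)
  then show ?thesis by simp
next
  case False
  have "\<bar>(u + v) / 2\<bar> powr a \<le> ((\<bar>u\<bar> + \<bar>v\<bar>) / 2) powr a"
    using a by (intro powr_mono2) auto
  also have "\<dots> < (\<bar>u\<bar> powr a + \<bar>v\<bar> powr a) / 2"
    using powr_midpoint_less[OF a, of "\<bar>u\<bar>" "\<bar>v\<bar>"] powr_midpoint_less[OF a, of "\<bar>v\<bar>" "\<bar>u\<bar>"] False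
    by (simp add: add.commute) linarith
  finally show ?thesis .
qed

text \<open>
  The scale parameter of \<open>\<integral> f dM\<close>, that is, the norm of \<open>f\<close> in \<open>L\<^sup>\<alpha>(m)\<close>.
\<close>
definition stable_scale :: "real \<Rightarrow> 'e measure \<Rightarrow> ('e \<Rightarrow> real) \<Rightarrow> real" where
  "stable_scale \<alpha> m f = (\<integral>x. \<bar>f x\<bar> powr \<alpha> \<partial>m) powr (1 / \<alpha>)"

lemma stable_scale_nonneg [simp]: "0 \<le> stable_scale \<alpha> m f"
  by (simp add: stable_scale_def)

lemma stable_scale_powr:
  assumes "0 < \<alpha>"
  shows "stable_scale \<alpha> m f powr \<alpha> = (\<integral>x. \<bar>f x\<bar> powr \<alpha> \<partial>m)"
  using assms by (simp add: stable_scale_def powr_powr)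

lemma stable_scale_eq_0_iff:
  "stable_scale \<alpha> m f = 0 \<longleftrightarrow> (\<integral>x. \<bar>f x\<bar> powr \<alpha> \<partial>m) = 0"
  by (simp add: stable_scale_def)

lemma AE_eq_0_if_stable_scale_eq_0:
  assumes "stable_integrable \<alpha> m f" "stable_scale \<alpha> m f = 0"
  shows "AE x in m. f x = 0"
proof -
  have "AE x in m. \<bar>f x\<bar> powr \<alpha> = 0"
    using assms by (subst integral_nonneg_eq_0_iff_AE[symmetric])
      (auto simp: stable_integrable_def stable_scale_eq_0_iff)
  then show ?thesis by eventually_elim simp
qed

lemma stable_scale_cong_AE:
  assumes "AE x in m. f x = g x" "f \<in> borel_measurable m" "g \<in> borel_measurable m"
  shows "stable_scale \<alpha> m f = stable_scale \<alpha> m g"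
  unfolding stable_scale_def
  by (intro arg_cong[where f = "\<lambda>s. s powr (1 / \<alpha>)"] integral_cong_AE)
     (use assms in \<open>auto elim!: eventually_mono\<close>)

lemma stable_integrable_cmult:
  assumes "stable_integrable \<alpha> m f"
  shows "stable_integrable \<alpha> m (\<lambda>x. c * f x)"
  using assms by (auto simp: stable_integrable_def abs_mult powr_mult)

lemma stable_scale_cmult:
  assumes "0 < \<alpha>"
  shows "stable_scale \<alpha> m (\<lambda>x. c * f x) = \<bar>c\<bar> * stable_scale \<alpha> m f"
  using assms by (simp add: stable_scale_def abs_mult powr_mult powr_powr)

text \<open>
  Convexity at the midpoint bounds \<open>\<bar>f + g\<bar> powr \<alpha>\<close> by \<open>2 powr (\<alpha> - 1) * (\<bar>f\<bar> powr \<alpha> + \<bar>g\<bar> powr \<alpha>)\<close>.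
\<close>
lemma stable_integrable_add:
  assumes a: "1 < \<alpha>" and f: "stable_integrable \<alpha> m f" and g: "stable_integrable \<alpha> m g"
  shows "stable_integrable \<alpha> m (\<lambda>x. f x + g x)"
  unfolding stable_integrable_def
proof
  have [measurable]: "f \<in> borel_measurable m" "g \<in> borel_measurable m"
    using f g by (auto simp: stable_integrable_def)
  show "(\<lambda>x. f x + g x) \<in> borel_measurable m" by measurable
  show "integrable m (\<lambda>x. \<bar>f x + g x\<bar> powr \<alpha>)"
  proof (rule Bochner_Integration.integrable_bound)
    show "integrable m (\<lambda>x. 2 powr \<alpha> * ((\<bar>f x\<bar> powr \<alpha> + \<bar>g x\<bar> powr \<alpha>) / 2))"
      using f g by (auto simp: stable_integrable_def)
    show "AE x in m. norm (\<bar>f x + g x\<bar> powr \<alpha>) \<le> norm (2 powr \<alpha> * ((\<bar>f x\<bar> powr \<alpha> + \<bar>g x\<bar> powr \<alpha>) / 2))"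
    proof (rule AE_I2)
      fix x
      have "\<bar>f x + g x\<bar> powr \<alpha> = 2 powr \<alpha> * \<bar>(f x + g x) / 2\<bar> powr \<alpha>"
        by (simp add: powr_divide)
      also have "\<dots> \<le> 2 powr \<alpha> * ((\<bar>f x\<bar> powr \<alpha> + \<bar>g x\<bar> powr \<alpha>) / 2)"
        by (intro mult_left_mono abs_powr_midpoint_le a) auto
      finally show "norm (\<bar>f x + g x\<bar> powr \<alpha>) \<le> norm (2 powr \<alpha> * ((\<bar>f x\<bar> powr \<alpha> + \<bar>g x\<bar> powr \<alpha>) / 2))"
        by simp
    qed
  qed measurable
qed

lemma stable_integrable_0: "stable_integrable \<alpha> m (\<lambda>x. 0)"
  by (simp add: stable_integrable_def)

lemma stable_integrable_sum:
  assumes "1 < \<alpha>" "\<And>i. i \<in> I \<Longrightarrow> stable_integrable \<alpha> m (f i)"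
  shows "stable_integrable \<alpha> m (\<lambda>x. \<Sum>i\<in>I. f i x)"
  using assms(2) by (induction I rule: infinite_finite_induct)
    (simp_all add: stable_integrable_0 stable_integrable_add[OF assms(1)])

lemma stable_integrable_diff:
  assumes "1 < \<alpha>" "stable_integrable \<alpha> m f" "stable_integrable \<alpha> m g"
  shows "stable_integrable \<alpha> m (\<lambda>x. f x - g x)"
  using stable_integrable_add[OF assms(1,2) stable_integrable_cmult[OF assms(3), of "-1"]] by simp

lemma stable_scale_minus_commute:
  "stable_scale \<alpha> m (\<lambda>x. f x - g x) = stable_scale \<alpha> m (\<lambda>x. g x - f x)"
  by (simp add: stable_scale_def abs_minus_commute)

text \<open>
  Minkowski's inequality. With \<open>A\<close> and \<open>B\<close> the norms of \<open>f\<close> and \<open>g\<close>, the quotient \<open>(\<bar>f\<bar> + \<bar>g\<bar>) / (A + B)\<close> is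
  the convex combination of \<open>\<bar>f\<bar> / A\<close> and \<open>\<bar>g\<bar> / B\<close> with weights \<open>A / (A + B)\<close> and \<open>B / (A + B)\<close>. Both of
  these functions have norm \<open>1\<close>, so integrating the convexity inequality shows that the norm of the
  combination is at most \<open>1\<close>.
\<close>
lemma stable_scale_triangle:
  assumes a: "1 < \<alpha>" and f: "stable_integrable \<alpha> m f" and g: "stable_integrable \<alpha> m g"
  shows "stable_scale \<alpha> m (\<lambda>x. f x + g x) \<le> stable_scale \<alpha> m f + stable_scale \<alpha> m g"
proof -
  define A where "A = stable_scale \<alpha> m f"
  define B where "B = stable_scale \<alpha> m g"
  have [measurable]: "f \<in> borel_measurable m" "g \<in> borel_measurable m"
    using f g by (auto simp: stable_integrable_def)
  consider "A = 0" | "B = 0" | "0 < A" "0 < B"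
    using stable_scale_nonneg[of \<alpha> m f] stable_scale_nonneg[of \<alpha> m g] unfolding A_def B_def by linarith
  then show ?thesis
  proof cases
    case 1
    then have "stable_scale \<alpha> m (\<lambda>x. f x + g x) = stable_scale \<alpha> m g"
      using AE_eq_0_if_stable_scale_eq_0[OF f] unfolding A_def
      by (intro stable_scale_cong_AE) (auto elim!: eventually_mono)
    then show ?thesis by simp
  next
    case 2
    then have "stable_scale \<alpha> m (\<lambda>x. f x + g x) = stable_scale \<alpha> m f"
      using AE_eq_0_if_stable_scale_eq_0[OF g] unfolding B_def
      by (intro stable_scale_cong_AE) (auto elim!: eventually_mono)
    then show ?thesis by simp
  next
    case 3
    define l where "l = B / (A + B)"
    have l: "0 \<le> l" "l \<le> 1" "1 - l = A / (A + B)" using 3 by (auto simp: l_def field_simps)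
    have int: "integrable m (\<lambda>x. \<bar>f x\<bar> powr \<alpha>)" "integrable m (\<lambda>x. \<bar>g x\<bar> powr \<alpha>)"
      using f g by (auto simp: stable_integrable_def)
    have pw: "\<bar>f x + g x\<bar> powr \<alpha> \<le> (A + B) powr \<alpha> *
        ((1 - l) * (\<bar>f x\<bar> powr \<alpha> / A powr \<alpha>) + l * (\<bar>g x\<bar> powr \<alpha> / B powr \<alpha>))" for x
    proof -
      have "\<bar>f x + g x\<bar> powr \<alpha> \<le> ((A + B) * ((1 - l) * (\<bar>f x\<bar> / A) + l * (\<bar>g x\<bar> / B))) powr \<alpha>"
      proof (rule powr_mono2)
        have "(A + B) * ((1 - l) * (\<bar>f x\<bar> / A) + l * (\<bar>g x\<bar> / B)) = \<bar>f x\<bar> + \<bar>g x\<bar>"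
          using 3 by (simp add: l(3) distrib_left) (simp add: l_def)
        then show "\<bar>f x + g x\<bar> \<le> (A + B) * ((1 - l) * (\<bar>f x\<bar> / A) + l * (\<bar>g x\<bar> / B))"
          using abs_triangle_ineq[of "f x" "g x"] by simp
      qed (use a in auto)
      also have "\<dots> = (A + B) powr \<alpha> * ((1 - l) * (\<bar>f x\<bar> / A) + l * (\<bar>g x\<bar> / B)) powr \<alpha>"
        using 3 l(1,2) by (intro powr_mult)
      also have "\<dots> \<le> (A + B) powr \<alpha> * ((1 - l) * (\<bar>f x\<bar> / A) powr \<alpha> + l * (\<bar>g x\<bar> / B) powr \<alpha>)"
        using 3 l by (intro mult_left_mono powr_convex_combination_le a) auto
      finally show ?thesis using 3 by (simp add: powr_divide)
    qed
    have "stable_scale \<alpha> m (\<lambda>x. f x + g x) powr \<alpha> = (\<integral>x. \<bar>f x + g x\<bar> powr \<alpha> \<partial>m)"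
      using a by (intro stable_scale_powr) auto
    also have "\<dots> \<le> (\<integral>x. (A + B) powr \<alpha> *
        ((1 - l) * (\<bar>f x\<bar> powr \<alpha> / A powr \<alpha>) + l * (\<bar>g x\<bar> powr \<alpha> / B powr \<alpha>)) \<partial>m)"
      using int pw stable_integrable_add[OF a f g]
      by (intro integral_mono) (auto simp: stable_integrable_def)
    also have "\<dots> = (A + B) powr \<alpha> * ((1 - l) * ((\<integral>x. \<bar>f x\<bar> powr \<alpha> \<partial>m) / A powr \<alpha>)
        + l * ((\<integral>x. \<bar>g x\<bar> powr \<alpha> \<partial>m) / B powr \<alpha>))"
      using int by simp
    also have "\<dots> = (A + B) powr \<alpha>"
      using 3 a by (simp add: A_def B_def flip: stable_scale_powr)
    finally have "stable_scale \<alpha> m (\<lambda>x. f x + g x) powr \<alpha> \<le> (A + B) powr \<alpha>" .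
    then show ?thesis
      using a 3 powr_less_mono2[of \<alpha> "A + B" "stable_scale \<alpha> m (\<lambda>x. f x + g x)"]
      unfolding A_def B_def by (force simp: not_le[symmetric])
  qed
qed

lemma abs_stable_scale_diff_le:
  assumes a: "1 < \<alpha>" and f: "stable_integrable \<alpha> m f" and g: "stable_integrable \<alpha> m g"
  shows "\<bar>stable_scale \<alpha> m f - stable_scale \<alpha> m g\<bar> \<le> stable_scale \<alpha> m (\<lambda>x. f x - g x)"
  using stable_scale_triangle[OF a stable_integrable_diff[OF a f g] g]
    stable_scale_triangle[OF a stable_integrable_diff[OF a g f] f]
  by (simp add: stable_scale_minus_commute[of \<alpha> m g f])

text \<open>
  Strict convexity of the norm on spheres: the integrand \<open>?F\<close> is the convexity defect, which is
  nonnegative everywhere and vanishes only where \<open>f = g\<close>.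
\<close>
lemma stable_scale_midpoint_less:
  assumes a: "1 < \<alpha>" and f: "stable_integrable \<alpha> m f" and g: "stable_integrable \<alpha> m g"
    and eq: "stable_scale \<alpha> m f = stable_scale \<alpha> m g"
    and ne: "stable_scale \<alpha> m (\<lambda>x. f x - g x) \<noteq> 0"
  shows "stable_scale \<alpha> m (\<lambda>x. (f x + g x) / 2) < stable_scale \<alpha> m f"
proof -
  let ?F = "\<lambda>x. (\<bar>f x\<bar> powr \<alpha> + \<bar>g x\<bar> powr \<alpha>) / 2 - \<bar>(f x + g x) / 2\<bar> powr \<alpha>"
  have [measurable]: "f \<in> borel_measurable m" "g \<in> borel_measurable m"
    using f g by (auto simp: stable_integrable_def)
  have int: "integrable m (\<lambda>x. \<bar>f x\<bar> powr \<alpha>)" "integrable m (\<lambda>x. \<bar>g x\<bar> powr \<alpha>)"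
    "integrable m (\<lambda>x. \<bar>(f x + g x) / 2\<bar> powr \<alpha>)"
    using f g stable_integrable_cmult[OF stable_integrable_add[OF a f g], of "1/2"]
    by (auto simp: stable_integrable_def)
  have nonneg: "0 \<le> ?F x" for x using abs_powr_midpoint_le[OF a, of "f x" "g x"] by simp
  have "integral\<^sup>L m ?F \<noteq> 0"
  proof
    assume "integral\<^sup>L m ?F = 0"
    then have "AE x in m. ?F x = 0"
      using int nonneg by (subst integral_nonneg_eq_0_iff_AE[symmetric]) auto
    then have "AE x in m. f x - g x = 0"
    proof eventually_elim
      case (elim x)
      then show ?case using abs_powr_midpoint_less[OF a, of "f x" "g x"] by fastforce
    qed
    then have "stable_scale \<alpha> m (\<lambda>x. f x - g x) = stable_scale \<alpha> m (\<lambda>x. 0)"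
      by (intro stable_scale_cong_AE) auto
    with ne show False by (simp add: stable_scale_def)
  qed
  then have "0 < integral\<^sup>L m ?F" using Bochner_Integration.integral_nonneg[of m ?F] nonneg by (simp add: less_le)
  also have "integral\<^sup>L m ?F = (stable_scale \<alpha> m f powr \<alpha> + stable_scale \<alpha> m g powr \<alpha>) / 2
      - stable_scale \<alpha> m (\<lambda>x. (f x + g x) / 2) powr \<alpha>"
    using int a by (simp add: stable_scale_powr)
  finally show ?thesis
    using a powr_mono2[of \<alpha> "stable_scale \<alpha> m f" "stable_scale \<alpha> m (\<lambda>x. (f x + g x) / 2)"]
    unfolding eq by (fastforce simp: not_le[symmetric])
qed

section \<open>Minimisers on Euclidean spaces\<close>

text \<open>
  On a finite-dimensional space a seminorm dominates the Euclidean norm once its kernel \<open>K\<close> is divided out: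
  on the orthogonal complement of \<open>K\<close> it is a norm, hence bounded away from \<open>0\<close> on the compact unit
  sphere of the complement. The vector \<open>w'\<close> is the orthogonal projection of \<open>w\<close> to the complement.
\<close>
lemma seminorm_bounded_below_mod_kernel:
  fixes p :: "'a::euclidean_space \<Rightarrow> real"
  assumes triangle: "\<And>x y. p (x + y) \<le> p x + p y"
    and scale: "\<And>c x. p (c *\<^sub>R x) = \<bar>c\<bar> * p x"
  obtains c where "0 < c" "\<And>w. \<exists>w'. p (w - w') = 0 \<and> c * norm w' \<le> p w"
proof -
  define K where "K = {k. p k = 0}"
  define S where "S = {z. norm z = 1 \<and> (\<forall>k\<in>K. k \<bullet> z = 0)}"
  have p0: "p 0 = 0" using scale[of 0 0] by simp
  have minus: "p (- x) = p x" for x using scale[of "-1" x] by simp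
  have nonneg: "0 \<le> p x" for x using triangle[of x "- x"] by (simp add: p0 minus)
  have K: "subspace K"
    unfolding subspace_def K_def
  proof safe
    fix x y assume "p x = 0" "p y = 0"
    then show "p (x + y) = 0" using triangle[of x y] nonneg[of "x + y"] by simp
  qed (simp_all add: p0 scale)
  have "convex_on UNIV p"
  proof (rule convex_onI)
    fix t :: real and x y :: 'a assume "0 < t" "t < 1"
    then show "p ((1 - t) *\<^sub>R x + t *\<^sub>R y) \<le> (1 - t) * p x + t * p y"
      using triangle[of "(1 - t) *\<^sub>R x" "t *\<^sub>R y"] by (simp add: scale)
  qed simp
  then have cont: "continuous_on UNIV p" by (rule convex_on_continuous[OF open_UNIV])
  have "closed {z. \<forall>k\<in>K. k \<bullet> z = 0}"
    unfolding Collect_ball_eq by (intro closed_INT ballI closed_hyperplane)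
  then have "compact (sphere 0 1 \<inter> {z. \<forall>k\<in>K. k \<bullet> z = 0})" by (intro compact_Int_closed) auto
  moreover have "sphere 0 1 \<inter> {z. \<forall>k\<in>K. k \<bullet> z = 0} = S" by (auto simp: S_def)
  ultimately have S: "compact S" by simp
  obtain c where c: "0 < c" "\<And>z. z \<in> S \<Longrightarrow> c \<le> p z"
  proof (cases "S = {}")
    case True
    then show ?thesis using that[of 1] by simp
  next
    case False
    then obtain z0 where z0: "z0 \<in> S" "\<And>z. z \<in> S \<Longrightarrow> p z0 \<le> p z"
      using continuous_attains_inf[OF S False continuous_on_subset[OF cont]] by blast
    have "p z0 \<noteq> 0"
    proof
      assume "p z0 = 0"
      then have "z0 \<bullet> z0 = 0" using z0(1) by (auto simp: S_def K_def)
      then show False using z0(1) by (simp add: S_def)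
    qed
    then show ?thesis using that[of "p z0"] z0(2) nonneg[of z0] by simp
  qed
  have "\<exists>w'. p (w - w') = 0 \<and> c * norm w' \<le> p w" for w
  proof -
    obtain y z where y: "y \<in> span K" and z: "\<And>k. k \<in> span K \<Longrightarrow> orthogonal z k" and w: "w = y + z"
      using orthogonal_subspace_decomp_exists[of K w] by metis
    have py: "p y = 0" using y K by (simp add: span_eq_iff K_def flip: span_eq_iff)
    have "c * norm z \<le> p z"
    proof (cases "z = 0")
      case True then show ?thesis by (simp add: p0)
    next
      case False
      have "(1 / norm z) *\<^sub>R z \<in> S"
        using z span_base[of _ K] False by (auto simp: S_def orthogonal_def inner_commute)
      then have "c \<le> p z / norm z" using c(2)[of "(1 / norm z) *\<^sub>R z"] by (simp add: scale)
      then show ?thesis using False by (simp add: field_simps)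
    qed
    also have "p z \<le> p w" using triangle[of w "- y"] by (simp add: w minus py)
    finally show ?thesis using py by (intro exI[of _ z]) (simp add: w)
  qed
  with c(1) show ?thesis by (rule that)
qed

text \<open>
  The kernel may be nontrivial, so \<open>\<Phi>\<close> need not tend to infinity. But \<open>\<Phi>\<close> does not change along the kernel,
  and every point can be moved along the kernel to one whose norm is controlled by \<open>p\<close>; outside a large
  ball such points have \<open>\<Phi>\<close> larger than \<open>\<Phi> 0\<close>.
\<close>
lemma continuous_coercive_mod_kernel_attains_inf:
  fixes p \<Phi> :: "'a::euclidean_space \<Rightarrow> real"
  assumes triangle: "\<And>x y. p (x + y) \<le> p x + p y"
    and scale: "\<And>c x. p (c *\<^sub>R x) = \<bar>c\<bar> * p x"
    and cont: "continuous_on UNIV \<Phi>"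
    and kernel: "\<And>v w. p (v - w) = 0 \<Longrightarrow> \<Phi> v = \<Phi> w"
    and coercive: "\<And>w. p w - C \<le> \<Phi> w"
  shows "\<exists>w. \<forall>v. \<Phi> w \<le> \<Phi> v"
proof -
  obtain c where c: "0 < c" "\<And>w. \<exists>w'. p (w - w') = 0 \<and> c * norm w' \<le> p w"
    using seminorm_bounded_below_mod_kernel[of p] triangle scale by metis
  define R where "R = (\<Phi> 0 + C) / c"
  have "0 \<le> R" using coercive[of 0] scale[of 0 0] c(1) by (simp add: R_def)
  then have "\<exists>w\<in>cball 0 R. \<forall>v\<in>cball 0 R. \<Phi> w \<le> \<Phi> v"
    using continuous_on_subset[OF cont] by (intro continuous_attains_inf) auto
  then obtain w where w: "\<And>v. norm v \<le> R \<Longrightarrow> \<Phi> w \<le> \<Phi> v"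
    unfolding mem_cball_0[symmetric] by blast
  have "\<Phi> w \<le> \<Phi> v" for v
  proof -
    obtain v' where v': "p (v - v') = 0" "c * norm v' \<le> p v" using c(2) by blast
    show ?thesis
    proof (cases "norm v' \<le> R")
      case True
      then show ?thesis using w[of v'] kernel[OF v'(1)] by simp
    next
      case False
      then have "\<Phi> 0 + C < c * norm v'" using c(1) by (simp add: R_def field_simps)
      then show ?thesis using v'(2) coercive[of v] w[of 0] \<open>0 \<le> R\<close> by simp
    qed
  qed
  then show ?thesis by blast
qed

text \<open>
  On the compact set \<open>?A\<close> of points of norm at most \<open>R\<close> at distance at least \<open>\<epsilon>\<close> from the strict minimiser
  \<open>w0\<close>, the function \<open>\<Phi>\<close> exceeds its minimum by some gap \<open>\<eta>\<close>. Once \<open>\<Psi> s\<close> is uniformly within \<open>\<eta> / 2\<close> of \<open>\<Phi>\<close>,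
  no minimiser of \<open>\<Psi> s\<close> can lie in \<open>?A\<close>.
\<close>
lemma tendsto_argmin:
  fixes \<Phi> :: "'a::euclidean_space \<Rightarrow> real" and \<Psi> :: "'b \<Rightarrow> 'a \<Rightarrow> real"
  assumes cont: "continuous_on UNIV \<Phi>"
    and strict: "\<And>v. v \<noteq> w0 \<Longrightarrow> \<Phi> w0 < \<Phi> v"
    and unif: "\<And>s v. \<bar>\<Psi> s v - \<Phi> v\<bar> \<le> e s" and e: "(e \<longlongrightarrow> 0) F"
    and argmin: "\<And>s v. \<Psi> s (w s) \<le> \<Psi> s v"
    and bounded: "eventually (\<lambda>s. norm (w s) \<le> R) F"
  shows "(w \<longlongrightarrow> w0) F"
proof (rule tendstoI)
  fix \<epsilon> :: real assume \<epsilon>: "0 < \<epsilon>"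
  let ?A = "cball 0 R - ball w0 \<epsilon>"
  have A: "compact ?A" by (intro compact_diff) auto
  obtain \<eta> where \<eta>: "0 < \<eta>" "\<And>v. v \<in> ?A \<Longrightarrow> \<Phi> w0 + \<eta> \<le> \<Phi> v"
  proof (cases "?A = {}")
    case True
    then show ?thesis by (intro that[of 1]) (simp, blast)
  next
    case False
    then obtain z where z: "z \<in> ?A" "\<And>v. v \<in> ?A \<Longrightarrow> \<Phi> z \<le> \<Phi> v"
      using continuous_attains_inf[OF A False continuous_on_subset[OF cont]] by blast
    have "z \<noteq> w0" using z(1) \<epsilon> by auto
    then show ?thesis using that[of "\<Phi> z - \<Phi> w0"] strict z(2) by simp
  qed
  have "eventually (\<lambda>s. \<bar>e s\<bar> < \<eta> / 2) F"
    using tendstoD[OF e, of "\<eta> / 2"] \<eta>(1) by (simp add: dist_norm)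
  with bounded show "eventually (\<lambda>s. dist (w s) w0 < \<epsilon>) F"
  proof eventually_elim
    case (elim s)
    have "\<Phi> (w s) < \<Phi> w0 + \<eta>"
      using unif[of s "w s"] unif[of s w0] argmin[of s w0] elim(2) by linarith
    then have "w s \<notin> ?A" using \<eta>(2)[of "w s"] by linarith
    then show ?case using elim(1) by (auto simp: dist_commute)
  qed
qed

section \<open>Best approximation by finite linear combinations\<close>

definition residual_scale ::
  "real \<Rightarrow> 'e measure \<Rightarrow> ('n::finite \<Rightarrow> 'e \<Rightarrow> real) \<Rightarrow> ('e \<Rightarrow> real) \<Rightarrow> real ^ 'n \<Rightarrow> real" where
  "residual_scale \<alpha> m F h w = stable_scale \<alpha> m (\<lambda>x. h x - (\<Sum>i\<in>UNIV. w $ i * F i x))"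

definition combination_scale ::
  "real \<Rightarrow> 'e measure \<Rightarrow> ('n::finite \<Rightarrow> 'e \<Rightarrow> real) \<Rightarrow> real ^ 'n \<Rightarrow> real" where
  "combination_scale \<alpha> m F w = stable_scale \<alpha> m (\<lambda>x. \<Sum>i\<in>UNIV. w $ i * F i x)"

text \<open>
  Minimising \<open>\<sigma> powr \<alpha>\<close> is the same as minimising \<open>\<sigma>\<close>, which satisfies the triangle inequality.
\<close>
lemma is_LSL_weights_iff:
  assumes "0 < \<alpha>"
  shows "is_LSL_weights \<alpha> m f t t0 w \<longleftrightarrow>
    (\<forall>v. residual_scale \<alpha> m (\<lambda>i. f (t i)) (f t0) w \<le> residual_scale \<alpha> m (\<lambda>i. f (t i)) (f t0) v)"
proof -
  have "error_scale_powr \<alpha> m f t t0 v = residual_scale \<alpha> m (\<lambda>i. f (t i)) (f t0) v powr \<alpha>" for v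
    using assms by (simp add: error_scale_powr_def residual_scale_def stable_scale_powr)
  moreover have "a powr \<alpha> \<le> b powr \<alpha> \<longleftrightarrow> a \<le> b" if "0 \<le> a" "0 \<le> b" for a b :: real
    using that assms powr_mono2[of \<alpha> a b] powr_less_mono2[of \<alpha> b a] by (force simp: not_le[symmetric])
  ultimately show ?thesis by (simp add: is_LSL_weights_def residual_scale_def)
qed

context
  fixes \<alpha> :: real and m :: "'e measure" and F :: "'n::finite \<Rightarrow> 'e \<Rightarrow> real"
  assumes \<alpha>: "1 < \<alpha>" and F: "\<And>i. stable_integrable \<alpha> m (F i)"
begin

lemma stable_integrable_combination: "stable_integrable \<alpha> m (\<lambda>x. \<Sum>i\<in>UNIV. (w :: real ^ 'n) $ i * F i x)"
  by (intro stable_integrable_sum stable_integrable_cmult \<alpha> F)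

lemma combination_scale_triangle:
  "combination_scale \<alpha> m F (v + w) \<le> combination_scale \<alpha> m F v + combination_scale \<alpha> m F w"
  using stable_scale_triangle[OF \<alpha> stable_integrable_combination[of v] stable_integrable_combination[of w]]
  by (simp add: combination_scale_def distrib_right sum.distrib)

lemma combination_scale_scaleR:
  "combination_scale \<alpha> m F (c *\<^sub>R w) = \<bar>c\<bar> * combination_scale \<alpha> m F w"
  using stable_scale_cmult[of \<alpha> m c "\<lambda>x. \<Sum>i\<in>UNIV. w $ i * F i x"] \<alpha>
  by (simp add: combination_scale_def sum_distrib_left mult.assoc)

context
  fixes h :: "'e \<Rightarrow> real"
  assumes h: "stable_integrable \<alpha> m h"
begin

lemma stable_integrable_residual:
  "stable_integrable \<alpha> m (\<lambda>x. h x - (\<Sum>i\<in>UNIV. (w :: real ^ 'n) $ i * F i x))"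
  by (rule stable_integrable_diff[OF \<alpha> h stable_integrable_combination])

text \<open>
  The residual is affine in the weights and the scale is a seminorm, so the residual scale is convex; a
  finite convex function on a Euclidean space is continuous.
\<close>
lemma continuous_on_residual_scale: "continuous_on UNIV (residual_scale \<alpha> m F h)"
proof (rule convex_on_continuous[OF open_UNIV], rule convex_onI)
  fix c :: real and v w :: "real ^ 'n" assume c: "0 < c" "c < 1"
  have "(\<lambda>x. h x - (\<Sum>i\<in>UNIV. ((1 - c) *\<^sub>R v + c *\<^sub>R w) $ i * F i x)) =
      (\<lambda>x. (1 - c) * (h x - (\<Sum>i\<in>UNIV. v $ i * F i x)) + c * (h x - (\<Sum>i\<in>UNIV. w $ i * F i x)))"
    by (auto simp: fun_eq_iff algebra_simps sum.distrib sum_subtractf sum_distrib_left)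
  then have "residual_scale \<alpha> m F h ((1 - c) *\<^sub>R v + c *\<^sub>R w) \<le>
      stable_scale \<alpha> m (\<lambda>x. (1 - c) * (h x - (\<Sum>i\<in>UNIV. v $ i * F i x))) +
      stable_scale \<alpha> m (\<lambda>x. c * (h x - (\<Sum>i\<in>UNIV. w $ i * F i x)))"
    unfolding residual_scale_def
    by (simp only:) (intro stable_scale_triangle \<alpha> stable_integrable_cmult stable_integrable_residual)
  then show "residual_scale \<alpha> m F h ((1 - c) *\<^sub>R v + c *\<^sub>R w) \<le>
      (1 - c) * residual_scale \<alpha> m F h v + c * residual_scale \<alpha> m F h w"
    using \<alpha> c by (simp add: residual_scale_def stable_scale_cmult)
qed simp

lemma combination_scale_diff:
  "combination_scale \<alpha> m F (v - w) = stable_scale \<alpha> m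
     (\<lambda>x. (h x - (\<Sum>i\<in>UNIV. w $ i * F i x)) - (h x - (\<Sum>i\<in>UNIV. v $ i * F i x)))"
  by (simp add: combination_scale_def left_diff_distrib sum_subtractf)

lemma residual_scale_mod_kernel:
  assumes "combination_scale \<alpha> m F (v - w) = 0"
  shows "residual_scale \<alpha> m F h v = residual_scale \<alpha> m F h w"
  using abs_stable_scale_diff_le[OF \<alpha> stable_integrable_residual stable_integrable_residual, of w v] assms
  by (simp add: residual_scale_def combination_scale_diff)

lemma combination_scale_le_residual_scale:
  "combination_scale \<alpha> m F w - stable_scale \<alpha> m h \<le> residual_scale \<alpha> m F h w"
  using abs_stable_scale_diff_le[OF \<alpha> stable_integrable_combination h, of w]
  by (simp add: combination_scale_def residual_scale_def stable_scale_minus_commute[of \<alpha> m h])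

lemma residual_scale_attains_min: "\<exists>w. \<forall>v. residual_scale \<alpha> m F h w \<le> residual_scale \<alpha> m F h v"
  by (rule continuous_coercive_mod_kernel_attains_inf
      [OF combination_scale_triangle combination_scale_scaleR continuous_on_residual_scale
        residual_scale_mod_kernel combination_scale_le_residual_scale])

text \<open>
  Minimising weights need not be unique, but the predictors they define are: if two residuals of minimal
  norm differed in \<open>L\<^sup>\<alpha>\<close>, their midpoint, which is again a residual, would have smaller norm.
\<close>
lemma residual_scale_argmin_unique_mod_kernel:
  assumes v: "\<And>u. residual_scale \<alpha> m F h v \<le> residual_scale \<alpha> m F h u"
    and w: "\<And>u. residual_scale \<alpha> m F h w \<le> residual_scale \<alpha> m F h u"
  shows "combination_scale \<alpha> m F (v - w) = 0"
proof (rule ccontr)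
  let ?r = "\<lambda>w x. h x - (\<Sum>i\<in>UNIV. (w :: real ^ 'n) $ i * F i x)"
  assume "combination_scale \<alpha> m F (v - w) \<noteq> 0"
  then have "stable_scale \<alpha> m (\<lambda>x. (?r w x + ?r v x) / 2) < stable_scale \<alpha> m (?r w)"
    using v[of w] w[of v] unfolding combination_scale_diff residual_scale_def
    by (intro stable_scale_midpoint_less \<alpha> stable_integrable_residual) auto
  also have "(\<lambda>x. (?r w x + ?r v x) / 2) = ?r ((1/2) *\<^sub>R (w + v))"
  proof
    fix x
    have "(\<Sum>i\<in>UNIV. ((1/2) *\<^sub>R (w + v)) $ i * F i x) =
        1/2 * ((\<Sum>i\<in>UNIV. w $ i * F i x) + (\<Sum>i\<in>UNIV. v $ i * F i x))"
      by (simp add: sum_distrib_left distrib_left distrib_right sum.distrib mult.assoc)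
    then show "(?r w x + ?r v x) / 2 = ?r ((1/2) *\<^sub>R (w + v)) x" by simp
  qed
  finally show False using w[of "(1/2) *\<^sub>R (w + v)"] by (simp add: residual_scale_def)
qed

end

text \<open>
  Changing the target from \<open>h\<close> to \<open>f s\<close> changes the residual scale by at most the norm of \<open>f s - h\<close>, uniformly in
  the weights. The minimising weights stay bounded: comparison with the weights \<open>0\<close> bounds the norm of
  the best combination by twice the norm of \<open>f s\<close>, and linear independence turns this into a bound on the
  weights.
\<close>
lemma tendsto_residual_scale_argmin:
  fixes f :: "'s \<Rightarrow> 'e \<Rightarrow> real"
  assumes f: "\<And>s. stable_integrable \<alpha> m (f s)" and h: "stable_integrable \<alpha> m h"
    and indep: "\<And>c. combination_scale \<alpha> m F c = 0 \<Longrightarrow> c = 0"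
    and lim: "((\<lambda>s. stable_scale \<alpha> m (\<lambda>x. f s x - h x)) \<longlongrightarrow> 0) G"
    and w: "\<And>s v. residual_scale \<alpha> m F (f s) (w s) \<le> residual_scale \<alpha> m F (f s) v"
    and w0: "\<And>v. residual_scale \<alpha> m F h w0 \<le> residual_scale \<alpha> m F h v"
  shows "(w \<longlongrightarrow> w0) G"
proof -
  obtain c where c: "0 < c" "\<And>v. \<exists>v'. combination_scale \<alpha> m F (v - v') = 0 \<and> c * norm v' \<le> combination_scale \<alpha> m F v"
    using seminorm_bounded_below_mod_kernel[of "combination_scale \<alpha> m F", OF combination_scale_triangle combination_scale_scaleR]
    by blast
  have lower: "c * norm v \<le> combination_scale \<alpha> m F v" for v
  proof -
    obtain v' where v': "combination_scale \<alpha> m F (v - v') = 0" "c * norm v' \<le> combination_scale \<alpha> m F v"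
      using c(2) by blast
    then show ?thesis using indep[OF v'(1)] by simp
  qed
  show ?thesis
  proof (rule tendsto_argmin)
    show "continuous_on UNIV (residual_scale \<alpha> m F h)" by (rule continuous_on_residual_scale[OF h])
    show "residual_scale \<alpha> m F h w0 < residual_scale \<alpha> m F h v" if "v \<noteq> w0" for v
    proof (rule ccontr)
      assume "\<not> residual_scale \<alpha> m F h w0 < residual_scale \<alpha> m F h v"
      then have "residual_scale \<alpha> m F h v \<le> residual_scale \<alpha> m F h u" for u
        using w0[of u] by simp
      then have "v - w0 = 0" by (intro indep residual_scale_argmin_unique_mod_kernel[OF h _ w0])
      with that show False by simp
    qed
    show "\<bar>residual_scale \<alpha> m F (f s) v - residual_scale \<alpha> m F h v\<bar> \<le> stable_scale \<alpha> m (\<lambda>x. f s x - h x)" for s v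
      using abs_stable_scale_diff_le[OF \<alpha> stable_integrable_residual[OF f] stable_integrable_residual[OF h], of s v v]
      by (simp add: residual_scale_def)
    show "((\<lambda>s. stable_scale \<alpha> m (\<lambda>x. f s x - h x)) \<longlongrightarrow> 0) G" by (rule lim)
    show "residual_scale \<alpha> m F (f s) (w s) \<le> residual_scale \<alpha> m F (f s) v" for s v by (rule w)
    have "eventually (\<lambda>s. stable_scale \<alpha> m (\<lambda>x. f s x - h x) < 1) G"
      using order_tendstoD(2)[OF lim, of 1] by simp
    then show "eventually (\<lambda>s. norm (w s) \<le> 2 * (stable_scale \<alpha> m h + 1) / c) G"
    proof eventually_elim
      case (elim s)
      have "c * norm (w s) \<le> residual_scale \<alpha> m F (f s) (w s) + stable_scale \<alpha> m (f s)"
        using lower[of "w s"] combination_scale_le_residual_scale[OF f, of "w s" s] by linarith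
      also have "\<dots> \<le> residual_scale \<alpha> m F (f s) 0 + stable_scale \<alpha> m (f s)" using w by simp
      also have "\<dots> = 2 * stable_scale \<alpha> m (f s)" by (simp add: residual_scale_def)
      also have "\<dots> \<le> 2 * (stable_scale \<alpha> m h + 1)"
      proof -
        have "stable_scale \<alpha> m (f s) - stable_scale \<alpha> m h \<le> stable_scale \<alpha> m (\<lambda>x. f s x - h x)"
          by (rule abs_le_D1[OF abs_stable_scale_diff_le[OF \<alpha> f h]])
        also have "\<dots> < 1" by (rule elim)
        finally show ?thesis by simp
      qed
      finally show ?case using c(1) by (simp add: field_simps)
    qed
  qed
qed

end

section \<open>Convergence in probability\<close>

lemma (in prob_space) converges_in_prob_linear:
  assumes U: "converges_in_prob M U u F" and V: "converges_in_prob M V v F"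
    and [measurable]: "\<And>k. U k \<in> borel_measurable M" "\<And>k. V k \<in> borel_measurable M"
      "\<And>k. W k \<in> borel_measurable M" "u \<in> borel_measurable M" "v \<in> borel_measurable M"
    and W: "\<And>k. AE \<omega> in M. W k \<omega> = a * U k \<omega> + b * V k \<omega>"
  shows "converges_in_prob M W (\<lambda>\<omega>. a * u \<omega> + b * v \<omega>) F"
  unfolding converges_in_prob_def
proof (intro allI impI)
  fix \<epsilon> :: real assume \<epsilon>: "0 < \<epsilon>"
  define \<delta> where "\<delta> = \<epsilon> / (\<bar>a\<bar> + \<bar>b\<bar> + 1)"
  have \<delta>: "0 < \<delta>" using \<epsilon> by (simp add: \<delta>_def add_nonneg_pos)
  have "\<bar>a\<bar> * \<delta> + \<bar>b\<bar> * \<delta> = \<epsilon> - \<delta>"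
    by (simp add: \<delta>_def divide_simps add_nonneg_eq_0_iff) (simp add: algebra_simps)
  then have sum: "\<bar>a\<bar> * \<delta> + \<bar>b\<bar> * \<delta> \<le> \<epsilon>" using \<delta> by simp
  have lim: "((\<lambda>k. measure M {\<omega> \<in> space M. \<bar>U k \<omega> - u \<omega>\<bar> > \<delta>} +
      measure M {\<omega> \<in> space M. \<bar>V k \<omega> - v \<omega>\<bar> > \<delta>}) \<longlongrightarrow> 0 + 0) F"
    using U V \<delta> unfolding converges_in_prob_def by (intro tendsto_add) auto
  show "((\<lambda>k. measure M {\<omega> \<in> space M. \<bar>W k \<omega> - (a * u \<omega> + b * v \<omega>)\<bar> > \<epsilon>}) \<longlongrightarrow> 0) F"
  proof (rule tendsto_sandwich[OF _ _ tendsto_const lim[simplified]]; intro always_eventually allI)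
    fix k
    have "measure M {\<omega> \<in> space M. \<bar>W k \<omega> - (a * u \<omega> + b * v \<omega>)\<bar> > \<epsilon>} \<le>
        measure M ({\<omega> \<in> space M. \<bar>U k \<omega> - u \<omega>\<bar> > \<delta>} \<union> {\<omega> \<in> space M. \<bar>V k \<omega> - v \<omega>\<bar> > \<delta>})"
    proof (rule finite_measure_mono_AE)
      show "AE \<omega> in M. \<omega> \<in> {\<omega> \<in> space M. \<bar>W k \<omega> - (a * u \<omega> + b * v \<omega>)\<bar> > \<epsilon>} \<longrightarrow>
          \<omega> \<in> {\<omega> \<in> space M. \<bar>U k \<omega> - u \<omega>\<bar> > \<delta>} \<union> {\<omega> \<in> space M. \<bar>V k \<omega> - v \<omega>\<bar> > \<delta>}"
        using W[of k]
      proof eventually_elim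
        case (elim \<omega>)
        have "\<bar>W k \<omega> - (a * u \<omega> + b * v \<omega>)\<bar> \<le> \<epsilon>"
          if "\<bar>U k \<omega> - u \<omega>\<bar> \<le> \<delta>" "\<bar>V k \<omega> - v \<omega>\<bar> \<le> \<delta>"
        proof -
          have "\<bar>W k \<omega> - (a * u \<omega> + b * v \<omega>)\<bar> = \<bar>a * (U k \<omega> - u \<omega>) + b * (V k \<omega> - v \<omega>)\<bar>"
            by (simp add: elim algebra_simps)
          also have "\<dots> \<le> \<bar>a\<bar> * \<bar>U k \<omega> - u \<omega>\<bar> + \<bar>b\<bar> * \<bar>V k \<omega> - v \<omega>\<bar>"
            using abs_triangle_ineq[of "a * (U k \<omega> - u \<omega>)" "b * (V k \<omega> - v \<omega>)"] by (simp add: abs_mult)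
          also have "\<dots> \<le> \<bar>a\<bar> * \<delta> + \<bar>b\<bar> * \<delta>"
            using that by (intro add_mono mult_left_mono) auto
          finally show ?thesis using sum by simp
        qed
        then show ?case by (auto simp: not_less[symmetric])
      qed
    qed measurable
    also have "\<dots> \<le> measure M {\<omega> \<in> space M. \<bar>U k \<omega> - u \<omega>\<bar> > \<delta>} +
        measure M {\<omega> \<in> space M. \<bar>V k \<omega> - v \<omega>\<bar> > \<delta>}"
      by (intro measure_Un_le) measurable
    finally show "measure M {\<omega> \<in> space M. \<bar>W k \<omega> - (a * u \<omega> + b * v \<omega>)\<bar> > \<epsilon>} \<le>
        measure M {\<omega> \<in> space M. \<bar>U k \<omega> - u \<omega>\<bar> > \<delta>} + measure M {\<omega> \<in> space M. \<bar>V k \<omega> - v \<omega>\<bar> > \<delta>}" .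
  qed simp
qed

lemma norm_iexp_diff_le: "cmod (iexp x - iexp y) \<le> \<bar>x - y\<bar>"
proof -
  have "iexp x - iexp y = iexp y * (iexp (x - y) - 1)"
    by (simp add: algebra_simps flip: exp_add)
  then have "cmod (iexp x - iexp y) = cmod (iexp (x - y) - 1)" by (simp add: norm_mult)
  also have "\<dots> \<le> \<bar>x - y\<bar>" using iexp_approx1[of "x - y" 0] by simp
  finally show ?thesis .
qed

text \<open>
  Convergence in probability implies convergence of the characteristic functions, here at the point \<open>1\<close>:
  where the variables differ by at most \<open>\<epsilon> / 2\<close> the exponentials do so too, and elsewhere they differ by at
  most \<open>2\<close>.
\<close>
lemma (in prob_space) iexp_converges_in_prob:
  assumes conv: "converges_in_prob M Y Z F"
    and [measurable]: "\<And>k. Y k \<in> borel_measurable M" "Z \<in> borel_measurable M"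
  shows "((\<lambda>k. CLINT \<omega>|M. iexp (Y k \<omega>)) \<longlongrightarrow> (CLINT \<omega>|M. iexp (Z \<omega>))) F"
proof (rule tendstoI)
  fix \<epsilon> :: real assume \<epsilon>: "0 < \<epsilon>"
  let ?B = "\<lambda>k. {\<omega> \<in> space M. \<bar>Y k \<omega> - Z \<omega>\<bar> > \<epsilon> / 2}"
  have bound: "dist (CLINT \<omega>|M. iexp (Y k \<omega>)) (CLINT \<omega>|M. iexp (Z \<omega>)) \<le> \<epsilon> / 2 + 2 * prob (?B k)" for k
  proof -
    have int: "integrable M (\<lambda>\<omega>. iexp (Y k \<omega>))" "integrable M (\<lambda>\<omega>. iexp (Z \<omega>))"
      by (auto intro!: integrable_iexp)
    have "dist (CLINT \<omega>|M. iexp (Y k \<omega>)) (CLINT \<omega>|M. iexp (Z \<omega>)) =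
        cmod (CLINT \<omega>|M. iexp (Y k \<omega>) - iexp (Z \<omega>))"
      using int by (simp add: dist_norm)
    also have "\<dots> \<le> (\<integral>\<omega>. cmod (iexp (Y k \<omega>) - iexp (Z \<omega>)) \<partial>M)"
      by (rule integral_norm_bound)
    also have "\<dots> \<le> (\<integral>\<omega>. \<epsilon> / 2 + 2 * indicator (?B k) \<omega> \<partial>M)"
    proof (rule integral_mono)
      show "integrable M (\<lambda>\<omega>. cmod (iexp (Y k \<omega>) - iexp (Z \<omega>)))" using int by simp
      show "integrable M (\<lambda>\<omega>. \<epsilon> / 2 + 2 * indicator (?B k) \<omega> :: real)"
        by (auto simp: emeasure_eq_measure)
      fix \<omega> assume "\<omega> \<in> space M"
      then show "cmod (iexp (Y k \<omega>) - iexp (Z \<omega>)) \<le> \<epsilon> / 2 + 2 * indicator (?B k) \<omega>"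
        using norm_iexp_diff_le[of "Y k \<omega>" "Z \<omega>"] \<epsilon> norm_triangle_ineq4[of "iexp (Y k \<omega>)" "iexp (Z \<omega>)"]
        by (auto simp: indicator_def)
    qed
    also have "\<dots> = \<epsilon> / 2 + 2 * prob (?B k)"
      by (subst Bochner_Integration.integral_add) (auto simp: emeasure_eq_measure prob_space)
    finally show ?thesis .
  qed
  have "((\<lambda>k. prob (?B k)) \<longlongrightarrow> 0) F"
    using conv half_gt_zero[OF \<epsilon>] unfolding converges_in_prob_def by blast
  then have "eventually (\<lambda>k. prob (?B k) < \<epsilon> / 4) F"
    using \<epsilon> by (auto dest: order_tendstoD(2)[of _ _ _ "\<epsilon> / 4"])
  then show "eventually (\<lambda>k. dist (CLINT \<omega>|M. iexp (Y k \<omega>)) (CLINT \<omega>|M. iexp (Z \<omega>)) < \<epsilon>) F"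
  proof eventually_elim
    case (elim k)
    then show ?case using bound[of k] by simp
  qed
qed

text \<open>
  If all weights \<open>c i\<close> are zero there is no average, and \<open>r = 0\<close> serves; for this reason the claim is a product.
\<close>
lemma weighted_average_in_unit_interval:
  fixes c \<rho> :: "'i \<Rightarrow> real"
  assumes "\<And>i. i \<in> I \<Longrightarrow> 0 \<le> c i" "\<And>i. i \<in> I \<Longrightarrow> \<bar>\<rho> i\<bar> \<le> 1"
  shows "\<exists>r\<in>{-1..1}. (\<Sum>i\<in>I. c i * \<rho> i) = r * (\<Sum>i\<in>I. c i)"
proof -
  have "\<bar>\<Sum>i\<in>I. c i * \<rho> i\<bar> \<le> (\<Sum>i\<in>I. \<bar>c i * \<rho> i\<bar>)" by (rule sum_abs)
  also have "\<dots> \<le> (\<Sum>i\<in>I. c i)"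
    using assms by (intro sum_mono) (auto simp: abs_mult intro: mult_left_le)
  finally have le: "\<bar>\<Sum>i\<in>I. c i * \<rho> i\<bar> \<le> (\<Sum>i\<in>I. c i)" .
  show ?thesis
  proof (cases "(\<Sum>i\<in>I. c i) = 0")
    case True
    then show ?thesis using le by (intro bexI[of _ 0]) auto
  next
    case False
    then have "0 < (\<Sum>i\<in>I. c i)" using le by linarith
    then show ?thesis
      using le by (intro bexI[of _ "(\<Sum>i\<in>I. c i * \<rho> i) / (\<Sum>i\<in>I. c i)"]) (auto simp: field_simps abs_le_iff)
  qed
qed

section \<open>The stable integral\<close>

locale stable_measure = prob_space P for P :: "'w measure" +
  fixes \<alpha> :: real and m :: "'e measure" and \<beta> :: "'e \<Rightarrow> real" and M :: "'e set \<Rightarrow> 'w \<Rightarrow> real"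
  assumes stable: "stable_random_measure P \<alpha> m \<beta> M"
begin

lemma stable_law:
  assumes "A \<in> fmeasurable m"
  shows "has_stable_law P (M A) \<alpha> (measure m A powr (1 / \<alpha>)) ((LINT x:A|m. \<beta> x) / measure m A) 0"
  using stable assms unfolding stable_random_measure_def by blast

lemma \<alpha>: "1 < \<alpha>" "\<alpha> \<le> 2"
  using stable_law[of "{}"] by (auto simp: has_stable_law_def)

lemma measurable_M: "A \<in> fmeasurable m \<Longrightarrow> M A \<in> borel_measurable P"
  using stable_law[of A] by (simp add: has_stable_law_def)

lemma indep_vars_M:
  fixes A :: "nat \<Rightarrow> 'e set"
  assumes "\<And>i. i < k \<Longrightarrow> A i \<in> fmeasurable m" "disjoint_family_on A {..<k}"
  shows "indep_vars (\<lambda>_. borel) (\<lambda>i. M (A i)) {..<k}"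
  using stable assms unfolding stable_random_measure_def by blast

lemma M_sums:
  fixes A :: "nat \<Rightarrow> 'e set"
  assumes "\<And>i. A i \<in> fmeasurable m" "disjoint_family A" "(\<Union>i. A i) \<in> fmeasurable m"
  shows "AE \<omega> in P. (\<lambda>i. M (A i) \<omega>) sums M (\<Union>i. A i) \<omega>"
  using stable assms unfolding stable_random_measure_def by blast

text \<open>
  A constant series converges only if its terms are zero.
\<close>
lemma M_empty: "AE \<omega> in P. M {} \<omega> = 0"
proof -
  have "AE \<omega> in P. (\<lambda>i::nat. M {} \<omega>) sums M (\<Union>i::nat. {}) \<omega>"
    by (intro M_sums) (auto simp: disjoint_family_on_def)
  then show ?thesis
    by eventually_elim (auto dest!: sums_summable simp: summable_const_iff)
qed

text \<open>
  Finite additivity is \<open>\<sigma>\<close>-additivity for the sequence continued by empty sets.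
\<close>
lemma M_finite_Union:
  assumes J: "finite J" and A: "\<And>j. j \<in> J \<Longrightarrow> A j \<in> fmeasurable m" and disj: "disjoint_family_on A J"
  shows "AE \<omega> in P. M (\<Union>j\<in>J. A j) \<omega> = (\<Sum>j\<in>J. M (A j) \<omega>)"
proof -
  obtain e where e: "bij_betw e {0..<card J} J" using ex_bij_betw_nat_finite[OF J] by blast
  define B where "B i = (if i < card J then A (e i) else {})" for i
  have eJ: "e i \<in> J" if "i < card J" for i using bij_betwE[OF e] that by auto
  have union: "(\<Union>i. B i) = (\<Union>j\<in>J. A j)"
  proof -
    have "(\<Union>i. B i) = (\<Union>i\<in>{0..<card J}. A (e i))" by (auto simp: B_def split: if_splits)
    also have "\<dots> = (\<Union>j\<in>e ` {0..<card J}. A j)" by simp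
    finally show ?thesis by (simp only: bij_betw_imp_surj_on[OF e])
  qed
  have "AE \<omega> in P. (\<lambda>i. M (B i) \<omega>) sums M (\<Union>i. B i) \<omega>"
  proof (rule M_sums)
    show "B i \<in> fmeasurable m" for i using A eJ by (auto simp: B_def)
    show "disjoint_family B"
      unfolding disjoint_family_on_def
    proof (intro ballI impI)
      fix i j :: nat assume "i \<noteq> j"
      moreover have "e i \<noteq> e j" if "i < card J" "j < card J"
        using bij_betw_imp_inj_on[OF e] that \<open>i \<noteq> j\<close> by (auto dest: inj_onD)
      ultimately show "B i \<inter> B j = {}"
        using disj eJ by (auto simp: B_def disjoint_family_on_def)
    qed
    show "(\<Union>i. B i) \<in> fmeasurable m"
      unfolding union using J A by (intro fmeasurable.finite_UN) auto
  qed
  with M_empty show ?thesis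
  proof eventually_elim
    case (elim \<omega>)
    have "(\<lambda>i. M (B i) \<omega>) sums (\<Sum>i\<in>{0..<card J}. M (B i) \<omega>)"
      using elim(1) by (intro sums_finite) (auto simp: B_def)
    then have "M (\<Union>j\<in>J. A j) \<omega> = (\<Sum>i\<in>{0..<card J}. M (B i) \<omega>)"
      using elim(2) unfolding union by (rule sums_unique2[symmetric])
    also have "\<dots> = (\<Sum>i\<in>{0..<card J}. M (A (e i)) \<omega>)" by (intro sum.cong) (auto simp: B_def)
    also have "\<dots> = (\<Sum>j\<in>J. M (A j) \<omega>)" by (rule sum.reindex_bij_betw[OF e])
    finally show ?case .
  qed
qed

text \<open>
  The integral of a simple function can be computed from any finite partition of its support on whose
  pieces it is constant, not only from its level sets. This allows several simple functions to be
  treated on a common partition. Empty pieces are excluded so that every value \<open>\<phi> p\<close> is attained.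
\<close>
lemma simple_stable_integral_eq_partition:
  assumes I: "finite I" and A: "\<And>p. p \<in> I \<Longrightarrow> A p \<in> fmeasurable m" "\<And>p. p \<in> I \<Longrightarrow> A p \<noteq> {}"
    and disj: "disjoint_family_on A I"
    and on: "\<And>p x. p \<in> I \<Longrightarrow> x \<in> A p \<Longrightarrow> g x = \<phi> p"
    and off: "\<And>x. x \<in> space m \<Longrightarrow> x \<notin> (\<Union>p\<in>I. A p) \<Longrightarrow> g x = 0"
  shows "AE \<omega> in P. simple_stable_integral m M g \<omega> = (\<Sum>p\<in>I. \<phi> p * M (A p) \<omega>)"
proof -
  have sp: "A p \<subseteq> space m" if "p \<in> I" for p
    using A(1)[OF that] by (auto simp: fmeasurable_def dest: sets.sets_into_space)
  have level: "{x \<in> space m. g x = y} = (\<Union>p\<in>{p\<in>I. \<phi> p = y}. A p)" if y0: "y \<noteq> 0" for y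
  proof (intro set_eqI iffI)
    fix x assume x: "x \<in> {x \<in> space m. g x = y}"
    then obtain p where p: "p \<in> I" "x \<in> A p" using off[of x] y0 by auto
    then show "x \<in> (\<Union>p\<in>{p\<in>I. \<phi> p = y}. A p)" using on[OF p] x by auto
  next
    fix x assume "x \<in> (\<Union>p\<in>{p\<in>I. \<phi> p = y}. A p)"
    then obtain p where p: "p \<in> I" "x \<in> A p" "\<phi> p = y" by auto
    then show "x \<in> {x \<in> space m. g x = y}" using on[OF p(1,2)] sp[OF p(1)] by auto
  qed
  have vals: "g ` space m - {0} = \<phi> ` I - {0}"
  proof (intro set_eqI iffI)
    fix y assume "y \<in> g ` space m - {0}"
    then obtain x where x: "x \<in> space m" "y = g x" "g x \<noteq> 0" by blast
    then obtain p where p: "p \<in> I" "x \<in> A p" using off[of x] by auto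
    then show "y \<in> \<phi> ` I - {0}" using x on[OF p] by auto
  next
    fix y assume "y \<in> \<phi> ` I - {0}"
    then obtain p where p: "p \<in> I" "y = \<phi> p" "y \<noteq> 0" by blast
    then obtain x where "x \<in> A p" using A(2) by blast
    then have "x \<in> space m" "y = g x" using sp[OF p(1)] on[OF p(1)] p(2) by auto
    then show "y \<in> g ` space m - {0}" using p(3) by blast
  qed
  have "AE \<omega> in P. \<forall>y\<in>\<phi> ` I - {0}.
      M (\<Union>p\<in>{p\<in>I. \<phi> p = y}. A p) \<omega> = (\<Sum>p\<in>{p\<in>I. \<phi> p = y}. M (A p) \<omega>)"
  proof (intro AE_finite_allI)
    show "AE \<omega> in P. M (\<Union>p\<in>{p\<in>I. \<phi> p = y}. A p) \<omega> = (\<Sum>p\<in>{p\<in>I. \<phi> p = y}. M (A p) \<omega>)" for y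
      using I A(1) disj by (intro M_finite_Union) (auto simp: disjoint_family_on_def)
  qed (use I in auto)
  then show ?thesis
  proof eventually_elim
    case (elim \<omega>)
    have "simple_stable_integral m M g \<omega> =
        (\<Sum>y\<in>\<phi> ` I - {0}. \<Sum>p\<in>{p\<in>I. \<phi> p = y}. \<phi> p * M (A p) \<omega>)"
      unfolding simple_stable_integral_def vals using elim
      by (intro sum.cong refl) (simp add: level sum_distrib_left)
    also have "\<dots> = (\<Sum>y\<in>\<phi> ` I. \<Sum>p\<in>{p\<in>I. \<phi> p = y}. \<phi> p * M (A p) \<omega>)"
      using I by (intro sum.mono_neutral_left) auto
    also have "\<dots> = (\<Sum>p\<in>I. \<phi> p * M (A p) \<omega>)"
      using I by (intro sum.group) auto
    finally show ?case .
  qed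
qed

lemma fmeasurable_level:
  assumes g: "Bochner_Integration.simple_bochner_integrable m g" and y: "y \<noteq> 0"
  shows "{x \<in> space m. g x = y} \<in> fmeasurable m"
proof (rule fmeasurableI)
  have sf: "simple_function m g" and fin: "emeasure m {x \<in> space m. g x \<noteq> 0} \<noteq> \<infinity>"
    using g by (auto elim: simple_bochner_integrable.cases)
  have [measurable]: "g \<in> measurable m (count_space UNIV)"
    using sf by (rule measurable_simple_function)
  show "{x \<in> space m. g x = y} \<in> sets m" by measurable
  have "emeasure m {x \<in> space m. g x = y} \<le> emeasure m {x \<in> space m. g x \<noteq> 0}"
    using y by (intro emeasure_mono) auto
  then show "emeasure m {x \<in> space m. g x = y} < \<infinity>"
    using fin neq_top_trans by (fastforce simp: less_top[symmetric])
qed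

lemma finite_simple_values: "Bochner_Integration.simple_bochner_integrable m g \<Longrightarrow> finite (g ` space m)"
  by (auto elim: simple_bochner_integrable.cases simp: simple_function_def)

lemma measurable_simple_stable_integral:
  assumes g: "Bochner_Integration.simple_bochner_integrable m g"
  shows "simple_stable_integral m M g \<in> borel_measurable P"
  unfolding simple_stable_integral_def[abs_def]
  by (intro borel_measurable_sum borel_measurable_times measurable_M fmeasurable_level g) auto

text \<open>
  All three integrals are evaluated on the common partition into the joint level sets of \<open>(g, h)\<close>. The value
  \<open>(0, 0)\<close> is left out because its level set may have infinite measure.
\<close>
lemma simple_stable_integral_linear:
  assumes g: "Bochner_Integration.simple_bochner_integrable m g" and h: "Bochner_Integration.simple_bochner_integrable m h"
  shows "AE \<omega> in P. simple_stable_integral m M (\<lambda>x. a * g x + b * h x) \<omega> =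
    a * simple_stable_integral m M g \<omega> + b * simple_stable_integral m M h \<omega>"
proof -
  define I where "I = (\<lambda>x. (g x, h x)) ` space m - {(0, 0)}"
  define A where "A p = {x \<in> space m. (g x, h x) = p}" for p
  have "I \<subseteq> g ` space m \<times> h ` space m" by (auto simp: I_def)
  then have I: "finite I"
    using finite_simple_values[OF g] finite_simple_values[OF h] by (meson finite_SigmaI finite_subset)
  have A: "A p \<in> fmeasurable m" "A p \<noteq> {}" if "p \<in> I" for p
  proof -
    show "A p \<noteq> {}" using that by (auto simp: I_def A_def)
    have sf [measurable]: "g \<in> measurable m (count_space UNIV)" "h \<in> measurable m (count_space UNIV)"
      using g h by (auto elim!: simple_bochner_integrable.cases intro: measurable_simple_function)
    have sets: "A p \<in> sets m"
    proof -
      have "A p = {x \<in> space m. g x = fst p} \<inter> {x \<in> space m. h x = snd p}" by (auto simp: A_def)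
      then show ?thesis by simp
    qed
    show "A p \<in> fmeasurable m"
    proof (cases "fst p = 0")
      case False
      then show ?thesis
        by (intro fmeasurableI2[OF fmeasurable_level[OF g False] _ sets]) (auto simp: A_def)
    next
      case True
      with that have "snd p \<noteq> 0" by (cases p) (auto simp: I_def)
      then show ?thesis
        by (intro fmeasurableI2[OF fmeasurable_level[OF h] _ sets]) (auto simp: A_def)
    qed
  qed
  have disj: "disjoint_family_on A I" by (auto simp: disjoint_family_on_def A_def)
  have off: "g x = 0 \<and> h x = 0" if "x \<in> space m" "x \<notin> (\<Union>p\<in>I. A p)" for x
    using that by (auto simp: I_def A_def)
  have off': "a * g x + b * h x = 0" if "x \<in> space m" "x \<notin> (\<Union>p\<in>I. A p)" for x
    using off[OF that] by simp
  have "AE \<omega> in P. simple_stable_integral m M g \<omega> = (\<Sum>p\<in>I. fst p * M (A p) \<omega>)"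
    using off by (intro simple_stable_integral_eq_partition I A disj) (auto simp: A_def)
  moreover have "AE \<omega> in P. simple_stable_integral m M h \<omega> = (\<Sum>p\<in>I. snd p * M (A p) \<omega>)"
    using off by (intro simple_stable_integral_eq_partition I A disj) (auto simp: A_def)
  moreover have "AE \<omega> in P. simple_stable_integral m M (\<lambda>x. a * g x + b * h x) \<omega> =
      (\<Sum>p\<in>I. (a * fst p + b * snd p) * M (A p) \<omega>)"
    using off' by (intro simple_stable_integral_eq_partition I A disj) (auto simp: A_def)
  ultimately show ?thesis
  proof eventually_elim
    case (elim \<omega>)
    then show ?case by (simp add: algebra_simps sum.distrib sum_distrib_left)
  qed
qed

lemma stable_integrable_simple:
  assumes g: "Bochner_Integration.simple_bochner_integrable m g"
  shows "stable_integrable \<alpha> m g"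
proof -
  have "Bochner_Integration.simple_bochner_integrable m (\<lambda>x. \<bar>g x\<bar> powr \<alpha>)"
    using simple_bochner_integrable_compose2[of "\<lambda>u v. \<bar>u\<bar> powr \<alpha>", OF _ g g] by simp
  then have "integrable m (\<lambda>x. \<bar>g x\<bar> powr \<alpha>)"
    using has_bochner_integral_simple_bochner_integrable integrable.intros by blast
  moreover have "g \<in> borel_measurable m"
    using g by (auto elim: simple_bochner_integrable.cases intro: borel_measurable_simple_function)
  ultimately show ?thesis by (simp add: stable_integrable_def)
qed

lemma LIMSEQ_stable_scale_iff:
  "(\<lambda>k. \<integral>x. \<bar>g k x - f x\<bar> powr \<alpha> \<partial>m) \<longlonglongrightarrow> 0 \<longleftrightarrow>
   (\<lambda>k. stable_scale \<alpha> m (\<lambda>x. g k x - f x)) \<longlonglongrightarrow> 0"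
proof
  assume "(\<lambda>k. \<integral>x. \<bar>g k x - f x\<bar> powr \<alpha> \<partial>m) \<longlonglongrightarrow> 0"
  then show "(\<lambda>k. stable_scale \<alpha> m (\<lambda>x. g k x - f x)) \<longlonglongrightarrow> 0"
    unfolding stable_scale_def using \<alpha> by (intro tendsto_zero_powrI tendsto_const) auto
next
  assume "(\<lambda>k. stable_scale \<alpha> m (\<lambda>x. g k x - f x)) \<longlonglongrightarrow> 0"
  then have "(\<lambda>k. stable_scale \<alpha> m (\<lambda>x. g k x - f x) powr \<alpha>) \<longlonglongrightarrow> 0"
    using \<alpha> by (intro tendsto_zero_powrI tendsto_const) auto
  then show "(\<lambda>k. \<integral>x. \<bar>g k x - f x\<bar> powr \<alpha> \<partial>m) \<longlonglongrightarrow> 0" using \<alpha> by (simp add: stable_scale_powr)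
qed

text \<open>
  If \<open>u\<close> and \<open>v\<close> approximate \<open>f\<close> and \<open>h\<close>, then \<open>a u + b v\<close> approximates \<open>a f + b h\<close> in \<open>L\<^sup>\<alpha>\<close> by Minkowski's
  inequality, and its integrals converge in probability to \<open>a Y + b Z\<close>.
\<close>
lemma has_stable_integral_linear:
  assumes f: "has_stable_integral P \<alpha> m M f Y" and h: "has_stable_integral P \<alpha> m M h Z"
  shows "has_stable_integral P \<alpha> m M (\<lambda>x. a * f x + b * h x) (\<lambda>\<omega>. a * Y \<omega> + b * Z \<omega>)"
proof -
  obtain u where u: "\<And>k. Bochner_Integration.simple_bochner_integrable m (u k)"
    "(\<lambda>k. \<integral>x. \<bar>u k x - f x\<bar> powr \<alpha> \<partial>m) \<longlonglongrightarrow> 0"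
    "converges_in_prob P (\<lambda>k. simple_stable_integral m M (u k)) Y sequentially"
    using f unfolding has_stable_integral_def by blast
  obtain v where v: "\<And>k. Bochner_Integration.simple_bochner_integrable m (v k)"
    "(\<lambda>k. \<integral>x. \<bar>v k x - h x\<bar> powr \<alpha> \<partial>m) \<longlonglongrightarrow> 0"
    "converges_in_prob P (\<lambda>k. simple_stable_integral m M (v k)) Z sequentially"
    using h unfolding has_stable_integral_def by blast
  have fi: "stable_integrable \<alpha> m f" "stable_integrable \<alpha> m h"
    and [measurable]: "Y \<in> borel_measurable P" "Z \<in> borel_measurable P"
    using f h by (auto simp: has_stable_integral_def)
  define w where "w k x = a * u k x + b * v k x" for k x
  have w: "Bochner_Integration.simple_bochner_integrable m (w k)" for k
    unfolding w_def[abs_def] by (rule simple_bochner_integrable_compose2[OF _ u(1) v(1)]) simp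
  have "(\<lambda>k. \<integral>x. \<bar>w k x - (a * f x + b * h x)\<bar> powr \<alpha> \<partial>m) \<longlonglongrightarrow> 0"
    unfolding LIMSEQ_stable_scale_iff
  proof (rule tendsto_sandwich[OF _ _ tendsto_const]; (intro always_eventually allI)?)
    fix k
    have i: "stable_integrable \<alpha> m (\<lambda>x. u k x - f x)" "stable_integrable \<alpha> m (\<lambda>x. v k x - h x)"
      using stable_integrable_diff[OF \<alpha>(1) stable_integrable_simple[OF u(1)] fi(1)]
        stable_integrable_diff[OF \<alpha>(1) stable_integrable_simple[OF v(1)] fi(2)] by auto
    have "stable_scale \<alpha> m (\<lambda>x. w k x - (a * f x + b * h x)) =
        stable_scale \<alpha> m (\<lambda>x. a * (u k x - f x) + b * (v k x - h x))"
      by (intro arg_cong[where f = "stable_scale \<alpha> m"]) (auto simp: w_def algebra_simps)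
    also have "\<dots> \<le> stable_scale \<alpha> m (\<lambda>x. a * (u k x - f x)) + stable_scale \<alpha> m (\<lambda>x. b * (v k x - h x))"
      by (intro stable_scale_triangle \<alpha> stable_integrable_cmult i)
    also have "\<dots> = \<bar>a\<bar> * stable_scale \<alpha> m (\<lambda>x. u k x - f x) + \<bar>b\<bar> * stable_scale \<alpha> m (\<lambda>x. v k x - h x)"
      using \<alpha> by (simp add: stable_scale_cmult)
    finally show "stable_scale \<alpha> m (\<lambda>x. w k x - (a * f x + b * h x)) \<le>
        \<bar>a\<bar> * stable_scale \<alpha> m (\<lambda>x. u k x - f x) + \<bar>b\<bar> * stable_scale \<alpha> m (\<lambda>x. v k x - h x)" .
  next
    have "(\<lambda>k. \<bar>a\<bar> * stable_scale \<alpha> m (\<lambda>x. u k x - f x) + \<bar>b\<bar> * stable_scale \<alpha> m (\<lambda>x. v k x - h x))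
        \<longlonglongrightarrow> \<bar>a\<bar> * 0 + \<bar>b\<bar> * 0"
      using u(2) v(2) unfolding LIMSEQ_stable_scale_iff by (intro tendsto_intros)
    then show "(\<lambda>k. \<bar>a\<bar> * stable_scale \<alpha> m (\<lambda>x. u k x - f x) + \<bar>b\<bar> * stable_scale \<alpha> m (\<lambda>x. v k x - h x)) \<longlonglongrightarrow> 0"
      by simp
  qed simp
  moreover have "converges_in_prob P (\<lambda>k. simple_stable_integral m M (w k)) (\<lambda>\<omega>. a * Y \<omega> + b * Z \<omega>) sequentially"
    unfolding w_def[abs_def]
    by (rule converges_in_prob_linear[OF u(3) v(3)])
       (auto intro!: measurable_simple_stable_integral simple_stable_integral_linear u(1) v(1) w[unfolded w_def[abs_def]])
  moreover have "stable_integrable \<alpha> m (\<lambda>x. a * f x + b * h x)"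
    by (intro stable_integrable_add \<alpha> stable_integrable_cmult fi)
  ultimately show ?thesis
    unfolding has_stable_integral_def using w by auto
qed

lemma has_stable_integral_0: "has_stable_integral P \<alpha> m M (\<lambda>x. 0) (\<lambda>\<omega>. 0)"
proof -
  have "Bochner_Integration.simple_bochner_integrable m (\<lambda>x. 0 :: real)"
    by (rule simple_bochner_integrable.intros) auto
  moreover have "simple_stable_integral m M (\<lambda>x. 0) = (\<lambda>\<omega>. 0)"
    by (auto simp: simple_stable_integral_def intro!: sum.neutral)
  ultimately show ?thesis
    unfolding has_stable_integral_def
    by (auto simp: stable_integrable_0 converges_in_prob_def intro!: exI[of _ "\<lambda>k x. 0"])
qed

lemma has_stable_integral_cmult:
  assumes "has_stable_integral P \<alpha> m M f Y"
  shows "has_stable_integral P \<alpha> m M (\<lambda>x. a * f x) (\<lambda>\<omega>. a * Y \<omega>)"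
  using has_stable_integral_linear[OF assms has_stable_integral_0, of a 0] by simp

lemma has_stable_integral_sum:
  assumes "\<And>i. i \<in> I \<Longrightarrow> has_stable_integral P \<alpha> m M (f i) (Y i)"
  shows "has_stable_integral P \<alpha> m M (\<lambda>x. \<Sum>i\<in>I. w i * f i x) (\<lambda>\<omega>. \<Sum>i\<in>I. w i * Y i \<omega>)"
  using assms
proof (induction I rule: infinite_finite_induct)
  case (insert i I)
  then show ?case
    using has_stable_integral_linear[of "f i" "Y i" "\<lambda>x. \<Sum>i\<in>I. w i * f i x" "\<lambda>\<omega>. \<Sum>i\<in>I. w i * Y i \<omega>" "w i" 1]
    by simp
qed (simp_all add: has_stable_integral_0)

section \<open>The law of a stable integral\<close>

text \<open>
  The values on the level sets are independent and stable, so the characteristic function is a product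
  of stable ones. Its exponents add up: the powers \<open>\<sigma> powr \<alpha>\<close> of the scales
  to \<open>\<integral> \<bar>g\<bar> powr \<alpha>\<close>, the skewness parameters to a weighted
  average \<open>r\<close> of numbers in \<open>[-1, 1]\<close>. Knowing \<open>r\<close> only up to membership in a
  compact set keeps the statement stable under limits. The statement is restricted to
  the argument \<open>1\<close>; other arguments \<open>\<theta>\<close> are reached by integrating \<open>\<theta> g\<close> in place of \<open>g\<close>.
\<close>
lemma iexp_simple_stable_integral:
  assumes g: "Bochner_Integration.simple_bochner_integrable m g"
  shows "\<exists>r\<in>{-1..1}. (CLINT \<omega>|P. iexp (simple_stable_integral m M g \<omega>)) =
    exp (- (complex_of_real (\<integral>x. \<bar>g x\<bar> powr \<alpha> \<partial>m) * (1 - \<i> * complex_of_real (r * tan (pi * \<alpha> / 2)))))"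
proof -
  define V where "V = g ` space m - {0}"
  define A where "A y = {x \<in> space m. g x = y}" for y
  have V: "finite V" using finite_simple_values[OF g] by (simp add: V_def)
  have A: "A y \<in> fmeasurable m" if "y \<in> V" for y
    using fmeasurable_level[OF g, of y] that by (auto simp: A_def V_def)
  define b where "b y = (LINT x:A y|m. \<beta> x) / measure m (A y)" for y
  define c where "c y = measure m (A y) * \<bar>y\<bar> powr \<alpha>" for y
  define \<rho> where "\<rho> y = b y * sgn y" for y
  have law: "has_stable_law P (M (A y)) \<alpha> (measure m (A y) powr (1 / \<alpha>)) (b y) 0" if "y \<in> V" for y
    using stable_law[OF A[OF that]] by (simp add: b_def)
  have \<rho>: "\<bar>\<rho> y\<bar> \<le> 1" if "y \<in> V" for y
    using law[OF that] by (auto simp: has_stable_law_def \<rho>_def abs_mult sgn_if)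
  obtain r where r: "r \<in> {-1..1}" "(\<Sum>y\<in>V. c y * \<rho> y) = r * (\<Sum>y\<in>V. c y)"
    using weighted_average_in_unit_interval[of V c \<rho>] \<rho> by (auto simp: c_def)
  obtain e where e: "bij_betw e {..<card V} V" using ex_bij_betw_nat_finite[OF V] by (auto simp: atLeast0LessThan)
  have eV: "e i \<in> V" if "i < card V" for i using bij_betwE[OF e] that by auto
  have e_inj: "e i \<noteq> e j" if "i < card V" "j < card V" "i \<noteq> j" for i j
    using bij_betw_imp_inj_on[OF e] that by (auto dest: inj_onD)
  have "indep_vars (\<lambda>_. borel) (\<lambda>i. M (A (e i))) {..<card V}"
    using A eV e_inj by (intro indep_vars_M) (auto simp: disjoint_family_on_def A_def)
  then have indep: "indep_vars (\<lambda>_. borel) (\<lambda>i \<omega>. e i * M (A (e i)) \<omega>) {..<card V}"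
    by (rule indep_vars_compose2) simp
  have char1: "char (distr P borel (\<lambda>\<omega>. y * M (A y) \<omega>)) 1 =
      exp (- (complex_of_real (c y) * (1 - \<i> * complex_of_real (\<rho> y * tan (pi * \<alpha> / 2)))))"
    if "y \<in> V" for y
  proof -
    have [measurable]: "M (A y) \<in> borel_measurable P" by (rule measurable_M[OF A[OF that]])
    have "char (distr P borel (\<lambda>\<omega>. y * M (A y) \<omega>)) 1 = char (distr P borel (M (A y))) y"
      by (simp add: char_def integral_distr)
    also have "\<dots> = stable_char \<alpha> (measure m (A y) powr (1 / \<alpha>)) (b y) 0 y"
      using law[OF that] by (simp add: has_stable_law_def)
    finally show ?thesis
      using \<alpha> by (simp add: stable_char_def powr_powr c_def \<rho>_def)
  qed
  have sum_e: "(\<lambda>\<omega>. \<Sum>i<card V. e i * M (A (e i)) \<omega>) = simple_stable_integral m M g"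
  proof
    fix \<omega>
    show "(\<Sum>i<card V. e i * M (A (e i)) \<omega>) = simple_stable_integral m M g \<omega>"
      using sum.reindex_bij_betw[OF e, of "\<lambda>y. y * M (A y) \<omega>"]
      by (simp add: simple_stable_integral_def V_def A_def)
  qed
  have "(CLINT \<omega>|P. iexp (simple_stable_integral m M g \<omega>)) =
      char (distr P borel (simple_stable_integral m M g)) 1"
    using measurable_simple_stable_integral[OF g] by (simp add: char_def integral_distr)
  also have "\<dots> = (\<Prod>i<card V. char (distr P borel (\<lambda>\<omega>. e i * M (A (e i)) \<omega>)) 1)"
    unfolding sum_e[symmetric] by (rule char_distr_sum[OF indep])
  also have "\<dots> = (\<Prod>y\<in>V. char (distr P borel (\<lambda>\<omega>. y * M (A y) \<omega>)) 1)"
    by (rule prod.reindex_bij_betw[OF e])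
  also have "\<dots> = exp (\<Sum>y\<in>V. - (complex_of_real (c y) * (1 - \<i> * complex_of_real (\<rho> y * tan (pi * \<alpha> / 2)))))"
    using V by (simp add: char1 exp_sum)
  also have "(\<Sum>y\<in>V. - (complex_of_real (c y) * (1 - \<i> * complex_of_real (\<rho> y * tan (pi * \<alpha> / 2))))) =
      - (complex_of_real (\<Sum>y\<in>V. c y) - \<i> * complex_of_real ((\<Sum>y\<in>V. c y * \<rho> y) * tan (pi * \<alpha> / 2)))"
    by (simp add: sum_negf sum_subtractf sum_distrib_left sum_distrib_right algebra_simps)
  also have "\<dots> = - (complex_of_real (\<Sum>y\<in>V. c y) * (1 - \<i> * complex_of_real (r * tan (pi * \<alpha> / 2))))"
    unfolding r(2) by (simp add: algebra_simps)
  also have "(\<Sum>y\<in>V. c y) = (\<integral>x. \<bar>g x\<bar> powr \<alpha> \<partial>m)"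
  proof -
    have "(\<integral>x. \<bar>g x\<bar> powr \<alpha> \<partial>m) = (\<integral>x. (\<Sum>y\<in>V. \<bar>y\<bar> powr \<alpha> * indicator (A y) x) \<partial>m)"
    proof (rule Bochner_Integration.integral_cong[OF refl])
      fix x assume x: "x \<in> space m"
      have "(\<Sum>y\<in>V. \<bar>y\<bar> powr \<alpha> * indicator (A y) x) = (\<Sum>y\<in>V. if y = g x then \<bar>y\<bar> powr \<alpha> else 0)"
        using x by (intro sum.cong) (auto simp: A_def indicator_def)
      also have "\<dots> = \<bar>g x\<bar> powr \<alpha>"
        using V x by (simp add: V_def)
      finally show "\<bar>g x\<bar> powr \<alpha> = (\<Sum>y\<in>V. \<bar>y\<bar> powr \<alpha> * indicator (A y) x)" ..
    qed
    also have "\<dots> = (\<Sum>y\<in>V. c y)"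
      using A by (subst Bochner_Integration.integral_sum) (auto simp: c_def mult.commute fmeasurable_def intro!: sum.cong)
    finally show ?thesis ..
  qed
  finally show ?thesis using r(1) by blast
qed

text \<open>
  The key lemma: the modulus of the characteristic function of \<open>\<integral> f dM\<close> determines the norm of \<open>f\<close>. The
  scales of the approximating simple functions converge by Minkowski's inequality. Their skewness
  parameters converge along a subsequence by compactness of \<open>[-1, 1]\<close>, which suffices to identify the form
  of the limit.
\<close>
lemma iexp_stable_integral:
  assumes f: "has_stable_integral P \<alpha> m M f Y"
  shows "\<exists>r\<in>{-1..1}. (CLINT \<omega>|P. iexp (Y \<omega>)) =
    exp (- (complex_of_real (\<integral>x. \<bar>f x\<bar> powr \<alpha> \<partial>m) * (1 - \<i> * complex_of_real (r * tan (pi * \<alpha> / 2)))))"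
proof -
  obtain u where u: "\<And>k. Bochner_Integration.simple_bochner_integrable m (u k)"
    "(\<lambda>k. \<integral>x. \<bar>u k x - f x\<bar> powr \<alpha> \<partial>m) \<longlonglongrightarrow> 0"
    "converges_in_prob P (\<lambda>k. simple_stable_integral m M (u k)) Y sequentially"
    using f unfolding has_stable_integral_def by blast
  have fi: "stable_integrable \<alpha> m f" and Y: "Y \<in> borel_measurable P"
    using f by (auto simp: has_stable_integral_def)
  define S where "S h = (\<integral>x. \<bar>h x\<bar> powr \<alpha> \<partial>m)" for h :: "'e \<Rightarrow> real"
  define \<psi> where "\<psi> s r = exp (- (complex_of_real s * (1 - \<i> * complex_of_real (r * tan (pi * \<alpha> / 2)))))"
    for s r :: real
  have "\<forall>k. \<exists>r\<in>{-1..1}. (CLINT \<omega>|P. iexp (simple_stable_integral m M (u k) \<omega>)) = \<psi> (S (u k)) r"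
    using iexp_simple_stable_integral[OF u(1)] unfolding \<psi>_def S_def by blast
  then obtain r where r: "\<And>k. r k \<in> {-1..1}"
    "\<And>k. (CLINT \<omega>|P. iexp (simple_stable_integral m M (u k) \<omega>)) = \<psi> (S (u k)) (r k)"
    by metis
  obtain l \<kappa> where l: "l \<in> {-1..1::real}" and \<kappa>: "strict_mono (\<kappa> :: nat \<Rightarrow> nat)" "(r \<circ> \<kappa>) \<longlonglongrightarrow> l"
    using compact_Icc[of "-1" "1::real"] r(1) unfolding compact_def by blast
  have "(\<lambda>k. stable_scale \<alpha> m (u k) - stable_scale \<alpha> m f) \<longlonglongrightarrow> 0"
  proof (rule Lim_null_comparison)
    show "\<forall>\<^sub>F k in sequentially. norm (stable_scale \<alpha> m (u k) - stable_scale \<alpha> m f) \<le>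
        stable_scale \<alpha> m (\<lambda>x. u k x - f x)"
      using abs_stable_scale_diff_le[OF \<alpha>(1) stable_integrable_simple[OF u(1)] fi] by simp
    show "(\<lambda>k. stable_scale \<alpha> m (\<lambda>x. u k x - f x)) \<longlonglongrightarrow> 0"
      using u(2) by (simp add: LIMSEQ_stable_scale_iff)
  qed
  then have "(\<lambda>k. stable_scale \<alpha> m (u k)) \<longlonglongrightarrow> stable_scale \<alpha> m f" by (rule LIM_zero_cancel)
  then have "(\<lambda>k. stable_scale \<alpha> m (u k) powr \<alpha>) \<longlonglongrightarrow> stable_scale \<alpha> m f powr \<alpha>"
    using \<alpha> by (intro tendsto_powr2 tendsto_const) auto
  then have "(\<lambda>k. S (u k)) \<longlonglongrightarrow> S f" using \<alpha> by (simp add: stable_scale_powr S_def)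
  then have "(\<lambda>k. S (u (\<kappa> k))) \<longlonglongrightarrow> S f"
    using LIMSEQ_subseq_LIMSEQ[OF _ \<kappa>(1)] by (fastforce simp: comp_def)
  then have "(\<lambda>k. \<psi> (S (u (\<kappa> k))) (r (\<kappa> k))) \<longlonglongrightarrow> \<psi> (S f) l"
    using \<kappa>(2) unfolding \<psi>_def comp_def by (intro tendsto_intros)
  moreover have "(\<lambda>k. CLINT \<omega>|P. iexp (simple_stable_integral m M (u k) \<omega>)) \<longlonglongrightarrow> (CLINT \<omega>|P. iexp (Y \<omega>))"
    by (intro iexp_converges_in_prob u(3) measurable_simple_stable_integral u(1) Y)
  then have "(\<lambda>k. \<psi> (S (u (\<kappa> k))) (r (\<kappa> k))) \<longlonglongrightarrow> (CLINT \<omega>|P. iexp (Y \<omega>))"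
    using LIMSEQ_subseq_LIMSEQ[OF _ \<kappa>(1)] unfolding r(2) by (fastforce simp: comp_def)
  ultimately have "(CLINT \<omega>|P. iexp (Y \<omega>)) = \<psi> (S f) l" by (rule LIMSEQ_unique[symmetric])
  then show ?thesis using l unfolding \<psi>_def S_def by blast
qed

lemma cmod_iexp_stable_integral:
  assumes "has_stable_integral P \<alpha> m M f Y"
  shows "cmod (CLINT \<omega>|P. iexp (Y \<omega>)) = exp (- (\<integral>x. \<bar>f x\<bar> powr \<alpha> \<partial>m))"
  using iexp_stable_integral[OF assms] by auto

text \<open>
  When the scale vanishes, the skewness term vanishes with it, so the characteristic function is \<open>1\<close>
  everywhere and \<open>Y\<close> has the law of the constant \<open>0\<close>.
\<close>
lemma AE_stable_integral_eq_0:
  assumes f: "has_stable_integral P \<alpha> m M f Y" and 0: "stable_scale \<alpha> m f = 0"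
  shows "AE \<omega> in P. Y \<omega> = 0"
proof -
  have [measurable]: "Y \<in> borel_measurable P" using f by (simp add: has_stable_integral_def)
  have "char (distr P borel Y) \<theta> = char (return borel 0) \<theta>" for \<theta>
  proof -
    have "stable_scale \<alpha> m (\<lambda>x. \<theta> * f x) = 0" using \<alpha> 0 by (simp add: stable_scale_cmult)
    then have "(\<integral>x. \<bar>\<theta> * f x\<bar> powr \<alpha> \<partial>m) = 0" by (simp only: stable_scale_eq_0_iff)
    then have "(CLINT \<omega>|P. iexp (\<theta> * Y \<omega>)) = 1"
      using iexp_stable_integral[OF has_stable_integral_cmult[OF f, of \<theta>]] by auto
    then show ?thesis by (simp add: char_def integral_distr integral_return)
  qed
  then have "distr P borel Y = return borel 0"
    by (intro Levy_uniqueness real_distribution_distr ext)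
       (auto simp: real_distribution_def real_distribution_axioms_def prob_space_return)
  moreover have "AE y in return borel (0::real). y = 0" by (subst AE_return) auto
  ultimately have "AE y in distr P borel Y. y = 0" by (simp only:)
  then show ?thesis by (simp add: AE_distr_iff)
qed

text \<open>
  For \<open>\<alpha> = 2\<close> the skewness term disappears since \<open>tan pi = 0\<close>, and \<open>Y\<close> is centred Gaussian with variance \<open>\<sigma>\<^sup>2\<close>.
  In this parametrisation \<open>\<sigma>\<close> is \<open>sqrt 2\<close> times the scale.
\<close>
lemma square_integrable_gaussian:
  assumes \<alpha>2: "\<alpha> = 2" and f: "has_stable_integral P \<alpha> m M f Y"
  shows "integrable P (\<lambda>\<omega>. (Y \<omega>)\<^sup>2)"
proof -
  have [measurable]: "Y \<in> borel_measurable P" using f by (simp add: has_stable_integral_def)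
  define \<sigma> where "\<sigma> = sqrt 2 * stable_scale \<alpha> m f"
  have "char (distr P borel Y) \<theta> = char (distr std_normal_distribution borel (\<lambda>x. \<sigma> * x)) \<theta>" for \<theta>
  proof -
    have "char (distr P borel Y) \<theta> = (CLINT \<omega>|P. iexp (\<theta> * Y \<omega>))"
      by (simp add: char_def integral_distr)
    also have "\<dots> = exp (- complex_of_real (\<integral>x. \<bar>\<theta> * f x\<bar> powr \<alpha> \<partial>m))"
      using iexp_stable_integral[OF has_stable_integral_cmult[OF f, of \<theta>]] by (auto simp: \<alpha>2)
    also have "(\<integral>x. \<bar>\<theta> * f x\<bar> powr \<alpha> \<partial>m) = stable_scale \<alpha> m (\<lambda>x. \<theta> * f x) powr \<alpha>"
      using \<alpha> by (intro stable_scale_powr[symmetric]) auto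
    also have "\<dots> = (\<theta> * \<sigma>)\<^sup>2 / 2"
      by (simp add: stable_scale_cmult \<alpha>2 \<sigma>_def power_mult_distrib)
    also have "exp (- complex_of_real ((\<theta> * \<sigma>)\<^sup>2 / 2)) = char std_normal_distribution (\<theta> * \<sigma>)"
    proof -
      have *: "exp (- complex_of_real x) = complex_of_real (exp (- x))" for x
        by (simp flip: exp_of_real)
      show ?thesis unfolding char_std_normal_distribution by (simp only: * minus_divide_left)
    qed
    also have "\<dots> = char (distr std_normal_distribution borel (\<lambda>x. \<sigma> * x)) \<theta>"
      by (simp add: char_def integral_distr mult.assoc)
    finally show ?thesis .
  qed
  moreover have "real_distribution (distr std_normal_distribution borel (\<lambda>x. \<sigma> * x))"
    using real_dist_normal_dist by (intro prob_space.real_distribution_distr) (auto simp: real_distribution_def)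
  ultimately have eq: "distr P borel Y = distr std_normal_distribution borel (\<lambda>x. \<sigma> * x)"
    by (intro Levy_uniqueness real_distribution_distr ext) auto
  have "integrable (distr std_normal_distribution borel (\<lambda>x. \<sigma> * x)) (\<lambda>y. y\<^sup>2)"
    using integrable_std_normal_distribution_moment[of 2]
    by (subst integrable_distr_eq) (auto simp: power_mult_distrib)
  then show ?thesis
    unfolding eq[symmetric] by (subst (asm) integrable_distr_eq) auto
qed

section \<open>Full dimension and stochastic continuity\<close>

text \<open>
  Full dimension makes the kernels \<open>F i\<close> linearly independent in \<open>L\<^sup>\<alpha>\<close>. Suppose \<open>\<Sum> c i F i = 0\<close> with \<open>c \<noteq> 0\<close>. For
  \<open>\<alpha> = 2\<close> the combination \<open>\<Sum> c i Y i\<close> is almost surely zero, so \<open>c\<close> is in the kernel of the covariance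
  matrix. For \<open>\<alpha> < 2\<close>, comparing the modulus of the characteristic function at \<open>c\<close> computed from the kernels
  and from the spectral measure \<open>\<Gamma>\<close> gives \<open>\<integral> \<bar>c \<bullet> s\<bar> powr \<alpha> d\<Gamma> = 0\<close>, so \<open>\<Gamma>\<close> is concentrated on the hyperplane
  orthogonal to \<open>c\<close>.
\<close>
lemma full_dimensional_imp_independent:
  fixes F :: "'n::finite \<Rightarrow> 'e \<Rightarrow> real" and Y :: "'n \<Rightarrow> 'w \<Rightarrow> real" and c :: "real ^ 'n"
  assumes F: "\<And>i. has_stable_integral P \<alpha> m M (F i) (Y i)"
    and full: "full_dimensional P \<alpha> (\<lambda>\<omega>. \<chi> i. Y i \<omega>)"
    and 0: "stable_scale \<alpha> m (\<lambda>x. \<Sum>i\<in>UNIV. c $ i * F i x) = 0"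
  shows "c = 0"
proof (rule ccontr)
  assume c: "c \<noteq> 0"
  have cF: "has_stable_integral P \<alpha> m M (\<lambda>x. \<Sum>i\<in>UNIV. c $ i * F i x) (\<lambda>\<omega>. \<Sum>i\<in>UNIV. c $ i * Y i \<omega>)"
    by (intro has_stable_integral_sum F)
  have [measurable]: "Y i \<in> borel_measurable P" for i using F by (simp add: has_stable_integral_def)
  show False
  proof (cases "\<alpha> = 2")
    case True
    have sq: "integrable P (\<lambda>\<omega>. (Y i \<omega>)\<^sup>2)" for i by (rule square_integrable_gaussian[OF True F])
    have int: "integrable P (Y i)" for i by (rule square_integrable_imp_integrable[OF _ sq]) measurable
    define D where "D i \<omega> = Y i \<omega> - (\<integral>\<omega>'. Y i \<omega>' \<partial>P)" for i \<omega>
    have [measurable]: "D i \<in> borel_measurable P" for i by (simp add: D_def[abs_def])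
    have sqD: "integrable P (\<lambda>\<omega>. (D i \<omega>)\<^sup>2)" for i
      using sq[of i] int[of i] by (simp add: D_def power2_diff)
    \<comment> \<open>Without integrable products the entries of the covariance matrix would be the default value \<open>0\<close> of the
      integral, and the quadratic form could not be computed inside the integral.\<close>
    have DD: "integrable P (\<lambda>\<omega>. D i \<omega> * D j \<omega>)" for i j
    proof (rule Bochner_Integration.integrable_bound)
      show "integrable P (\<lambda>\<omega>. (D i \<omega>)\<^sup>2 + (D j \<omega>)\<^sup>2)" by (intro Bochner_Integration.integrable_add sqD)
      have "\<bar>u * v\<bar> \<le> u\<^sup>2 + v\<^sup>2" for u v :: real
      proof -
        have "2 * (\<bar>u\<bar> * \<bar>v\<bar>) \<le> u\<^sup>2 + v\<^sup>2"
          using sum_squares_bound[of "\<bar>u\<bar>" "\<bar>v\<bar>"] by (simp add: mult.assoc)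
        moreover have "0 \<le> \<bar>u\<bar> * \<bar>v\<bar>" by simp
        ultimately show ?thesis unfolding abs_mult by linarith
      qed
      then show "AE \<omega> in P. norm (D i \<omega> * D j \<omega>) \<le> norm ((D i \<omega>)\<^sup>2 + (D j \<omega>)\<^sup>2)"
        by simp
    qed measurable
    have Z: "AE \<omega> in P. (\<Sum>i\<in>UNIV. c $ i * Y i \<omega>) = 0"
      by (rule AE_stable_integral_eq_0[OF cF 0])
    have "(\<integral>\<omega>. (\<Sum>i\<in>UNIV. c $ i * Y i \<omega>) \<partial>P) = (\<integral>\<omega>. 0 \<partial>P)"
      using Z by (intro integral_cong_AE) auto
    then have mean: "(\<Sum>i\<in>UNIV. c $ i * (\<integral>\<omega>. Y i \<omega> \<partial>P)) = 0"
      using int by simp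
    have "covariance_matrix P (\<lambda>\<omega>. \<chi> i. Y i \<omega>) *v c = 0"
      unfolding vec_eq_iff
    proof
      fix i
      have "(covariance_matrix P (\<lambda>\<omega>. \<chi> i. Y i \<omega>) *v c) $ i = (\<Sum>j\<in>UNIV. (\<integral>\<omega>. D i \<omega> * D j \<omega> \<partial>P) * c $ j)"
        by (simp add: covariance_matrix_def matrix_vector_mult_def D_def)
      also have "\<dots> = (\<integral>\<omega>. (\<Sum>j\<in>UNIV. (D i \<omega> * D j \<omega>) * c $ j) \<partial>P)"
        using DD by simp
      also have "\<dots> = (\<integral>\<omega>. 0 \<partial>P)"
      proof (rule integral_cong_AE)
        show "AE \<omega> in P. (\<Sum>j\<in>UNIV. (D i \<omega> * D j \<omega>) * c $ j) = 0"
          using Z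
        proof eventually_elim
          case (elim \<omega>)
          have "(\<Sum>j\<in>UNIV. (D i \<omega> * D j \<omega>) * c $ j) = D i \<omega> * (\<Sum>j\<in>UNIV. c $ j * D j \<omega>)"
            by (simp add: sum_distrib_left mult_ac)
          also have "(\<Sum>j\<in>UNIV. c $ j * D j \<omega>) = 0"
            using elim mean by (simp add: D_def right_diff_distrib sum_subtractf)
          finally show ?case by simp
        qed
      qed measurable
      finally show "(covariance_matrix P (\<lambda>\<omega>. \<chi> i. Y i \<omega>) *v c) $ i = 0 $ i" by simp
    qed
    moreover have "invertible (covariance_matrix P (\<lambda>\<omega>. \<chi> i. Y i \<omega>))"
      using full True by (simp add: full_dimensional_def)
    ultimately show False
      using c unfolding invertible_left_inverse matrix_left_invertible_ker by blast
  next
    case False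
    then obtain \<Gamma> where \<Gamma>: "is_spectral_measure P \<alpha> (\<lambda>\<omega>. \<chi> i. Y i \<omega>) \<Gamma>"
      and notin: "\<not> (\<exists>V. subspace V \<and> dim V = CARD('n) - 1 \<and> (AE s in \<Gamma>. s \<in> V))"
      using full by (auto simp: full_dimensional_def)
    interpret \<Gamma>: finite_measure \<Gamma> using \<Gamma> by (simp add: is_spectral_measure_def)
    have sets: "sets \<Gamma> = sets (restrict_space borel (sphere 0 1))"
      using \<Gamma> by (simp add: is_spectral_measure_def)
    then have space: "space \<Gamma> = sphere 0 1"
      by (auto dest: sets_eq_imp_space_eq simp: space_restrict_space)
    have meas: "h \<in> borel_measurable \<Gamma>" if "h \<in> borel_measurable borel"
      for h :: "real ^ 'n \<Rightarrow> 'z :: topological_space"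
      using measurable_restrict_space1[OF that] by (simp add: measurable_cong_sets[OF sets refl])
    obtain \<mu> where \<mu>: "(CLINT \<omega>|P. iexp (\<theta> \<bullet> (\<chi> i. Y i \<omega>))) =
        exp (- (CLINT s|\<Gamma>. complex_of_real (\<bar>\<theta> \<bullet> s\<bar> powr \<alpha>)
                  * (1 - \<i> * complex_of_real (sgn (\<theta> \<bullet> s) * tan (pi * \<alpha> / 2))))
             + \<i> * complex_of_real (\<theta> \<bullet> \<mu>))" for \<theta>
      using \<Gamma> unfolding is_spectral_measure_def by blast
    let ?h = "\<lambda>s. complex_of_real (\<bar>c \<bullet> s\<bar> powr \<alpha>) * (1 - \<i> * complex_of_real (sgn (c \<bullet> s) * tan (pi * \<alpha> / 2)))"
    have bound: "\<bar>c \<bullet> s\<bar> powr \<alpha> \<le> norm c powr \<alpha>" if "s \<in> space \<Gamma>" for s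
      using that \<alpha> Cauchy_Schwarz_ineq2[of c s] by (intro powr_mono2) (auto simp: space)
    have inth: "integrable \<Gamma> ?h"
    proof (rule \<Gamma>.integrable_const_bound)
      show "AE s in \<Gamma>. cmod (?h s) \<le> norm c powr \<alpha> * (1 + \<bar>tan (pi * \<alpha> / 2)\<bar>)"
      proof (rule AE_I2)
        fix s assume s: "s \<in> space \<Gamma>"
        have "cmod (1 - \<i> * complex_of_real (sgn (c \<bullet> s) * tan (pi * \<alpha> / 2))) \<le>
            1 + \<bar>sgn (c \<bullet> s) * tan (pi * \<alpha> / 2)\<bar>"
          using norm_triangle_ineq4[of 1 "\<i> * complex_of_real (sgn (c \<bullet> s) * tan (pi * \<alpha> / 2))"]
          by (simp add: norm_mult abs_mult)
        also have "\<dots> \<le> 1 + \<bar>tan (pi * \<alpha> / 2)\<bar>" by (simp add: abs_mult sgn_if)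
        finally show "cmod (?h s) \<le> norm c powr \<alpha> * (1 + \<bar>tan (pi * \<alpha> / 2)\<bar>)"
          unfolding norm_mult using bound[OF s] by (intro mult_mono) auto
      qed
      show "?h \<in> borel_measurable \<Gamma>" by (rule meas) measurable
    qed
    have "AE s in \<Gamma>. \<bar>c \<bullet> s\<bar> powr \<alpha> = 0"
    proof (subst integral_nonneg_eq_0_iff_AE[symmetric])
      have "integrable \<Gamma> (\<lambda>s. Re (?h s))" using inth by (rule integrable_Re)
      then show "integrable \<Gamma> (\<lambda>s. \<bar>c \<bullet> s\<bar> powr \<alpha>)" by simp
      have "exp (- Re (CLINT s|\<Gamma>. ?h s)) = cmod (CLINT \<omega>|P. iexp (c \<bullet> (\<chi> i. Y i \<omega>)))"
        unfolding \<mu> by simp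
      also have "\<dots> = exp (- (\<integral>x. \<bar>\<Sum>i\<in>UNIV. c $ i * F i x\<bar> powr \<alpha> \<partial>m))"
        using cmod_iexp_stable_integral[OF cF] by (simp add: inner_vec_def)
      also have "\<dots> = 1" using 0 by (simp add: stable_scale_eq_0_iff)
      finally have "Re (CLINT s|\<Gamma>. ?h s) = 0" by simp
      moreover have "Re (CLINT s|\<Gamma>. ?h s) = (LINT s|\<Gamma>. Re (?h s))" by (rule integral_Re[OF inth, symmetric])
      ultimately show "(LINT s|\<Gamma>. \<bar>c \<bullet> s\<bar> powr \<alpha>) = 0" by simp
    qed auto
    then have "AE s in \<Gamma>. s \<in> {s. c \<bullet> s = 0}" by eventually_elim auto
    moreover have "dim {s. c \<bullet> s = 0} = CARD('n) - 1" using dim_hyperplane[OF c] by simp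
    ultimately show False using notin subspace_hyperplane[of c] by blast
  qed
qed

text \<open>
  Convergence in probability of \<open>X s - X t\<close> to \<open>0\<close> makes the moduli of the characteristic functions tend to \<open>1\<close>,
  and these moduli are \<open>exp (- \<sigma> powr \<alpha>)\<close> with \<open>\<sigma>\<close> the norm of \<open>f s - f t\<close>.
\<close>
lemma stochastically_continuous_imp_scale_tendsto:
  fixes f :: "'a::topological_space \<Rightarrow> 'e \<Rightarrow> real"
  assumes f: "\<And>s. has_stable_integral P \<alpha> m M (f s) (X s)"
    and cont: "stochastically_continuous P X"
  shows "((\<lambda>s. stable_scale \<alpha> m (\<lambda>x. f s x - f t x)) \<longlongrightarrow> 0) (at t)"
proof -
  have [measurable]: "X s \<in> borel_measurable P" for s using f by (simp add: has_stable_integral_def)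
  define S where "S s = (\<integral>x. \<bar>f s x - f t x\<bar> powr \<alpha> \<partial>m)" for s
  have "converges_in_prob P (\<lambda>s \<omega>. X s \<omega> - X t \<omega>) (\<lambda>\<omega>. 0) (at t)"
    using cont by (simp add: stochastically_continuous_def converges_in_prob_def)
  then have "((\<lambda>s. CLINT \<omega>|P. iexp (X s \<omega> - X t \<omega>)) \<longlongrightarrow> (CLINT \<omega>|P. iexp 0)) (at t)"
    by (rule iexp_converges_in_prob) measurable
  from tendsto_norm[OF this]
  have "((\<lambda>s. cmod (CLINT \<omega>|P. iexp (X s \<omega> - X t \<omega>))) \<longlongrightarrow> 1) (at t)"
    by (simp add: prob_space)
  moreover have "cmod (CLINT \<omega>|P. iexp (X s \<omega> - X t \<omega>)) = exp (- S s)" for s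
    using cmod_iexp_stable_integral[OF has_stable_integral_linear[OF f f, of 1 s "-1" t]] by (simp add: S_def)
  ultimately have "((\<lambda>s. exp (- S s)) \<longlongrightarrow> 1) (at t)" by simp
  then have "((\<lambda>s. - ln (exp (- S s))) \<longlongrightarrow> - ln 1) (at t)"
    by (intro tendsto_intros) auto
  then have "(S \<longlongrightarrow> 0) (at t)" by simp
  then show ?thesis
    unfolding stable_scale_def S_def using \<alpha> by (intro tendsto_zero_powrI tendsto_const) auto
qed

end

section \<open>The least scale linear predictor\<close>

theorem theorem8:
  fixes P :: "'w measure"
    and m :: "'e measure"
    and \<beta> :: "'e \<Rightarrow> real"
    and M :: "'e set \<Rightarrow> 'w \<Rightarrow> real"
    and f :: "real ^ 'd \<Rightarrow> 'e \<Rightarrow> real"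
    and X :: "real ^ 'd \<Rightarrow> 'w \<Rightarrow> real"
    and t :: "'n::finite \<Rightarrow> real ^ 'd"
    and \<alpha> :: real
  assumes "prob_space P"
    and "1 < \<alpha>" and "\<alpha> \<le> 2"
    and "stable_random_measure P \<alpha> m \<beta> M"
    and "\<And>s. stable_integrable \<alpha> m (f s)"
    and "\<And>s. has_stable_integral P \<alpha> m M (f s) (X s)"
    and "inj t"
  shows
    "((\<forall>t0. \<exists>Y. is_LSL_predictor \<alpha> m f X t t0 Y) \<and>
      (\<forall>t0 Y Y'. is_LSL_predictor \<alpha> m f X t t0 Y \<and> is_LSL_predictor \<alpha> m f X t t0 Y' \<longrightarrow>
         (AE \<omega> in P. Y \<omega> = Y' \<omega>)) \<and>
      (\<forall>t0 Y i. is_LSL_predictor \<alpha> m f X t t0 Y \<and> t0 = t i \<longrightarrow>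
         (AE \<omega> in P. Y \<omega> = X t0 \<omega>))) \<and>
     (stochastically_continuous P X \<and> full_dimensional P \<alpha> (\<lambda>\<omega>. \<chi> i. X (t i) \<omega>) \<longrightarrow>
      (\<forall>w :: real ^ 'd \<Rightarrow> real ^ 'n. (\<forall>t0. is_LSL_weights \<alpha> m f t t0 (w t0)) \<longrightarrow>
         (\<forall>i. continuous_on UNIV (\<lambda>s. w s $ i))))"
proof (intro conjI allI impI)
  interpret stable_measure P \<alpha> m \<beta> M
    using assms(1,4) by (simp add: stable_measure_def stable_measure_axioms_def)
  note f = assms(5) and X = assms(6)
  let ?F = "\<lambda>i. f (t i)"
  have F: "\<And>i. stable_integrable \<alpha> m (?F i)" by (rule f)
  have weights: "is_LSL_weights \<alpha> m f t t0 w \<longleftrightarrow>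
      (\<forall>v. residual_scale \<alpha> m ?F (f t0) w \<le> residual_scale \<alpha> m ?F (f t0) v)" for t0 w
    using \<alpha> by (intro is_LSL_weights_iff) simp
  have AE_eq: "AE \<omega> in P. Y \<omega> = Z \<omega>"
    if "has_stable_integral P \<alpha> m M g Y" "has_stable_integral P \<alpha> m M h Z"
      "stable_scale \<alpha> m (\<lambda>x. g x - h x) = 0" for g h Y Z
    using AE_stable_integral_eq_0[OF has_stable_integral_linear[OF that(1,2), of 1 "-1"]] that(3) by simp
  have predictor: "has_stable_integral P \<alpha> m M (\<lambda>x. \<Sum>i\<in>UNIV. w $ i * f (t i) x)
      (\<lambda>\<omega>. \<Sum>i\<in>UNIV. w $ i * X (t i) \<omega>)" for w :: "real ^ 'n"
    by (intro has_stable_integral_sum X)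

  fix t0
  show "\<exists>Y. is_LSL_predictor \<alpha> m f X t t0 Y"
    using residual_scale_attains_min[where F = ?F, OF \<alpha>(1) F f[of t0]] unfolding is_LSL_predictor_def weights by blast

  show "AE \<omega> in P. Y \<omega> = Y' \<omega>"
    if YY: "is_LSL_predictor \<alpha> m f X t t0 Y \<and> is_LSL_predictor \<alpha> m f X t t0 Y'" for Y Y'
  proof -
    obtain v w where v: "is_LSL_weights \<alpha> m f t t0 v" "Y = (\<lambda>\<omega>. \<Sum>i\<in>UNIV. v $ i * X (t i) \<omega>)"
      and w: "is_LSL_weights \<alpha> m f t t0 w" "Y' = (\<lambda>\<omega>. \<Sum>i\<in>UNIV. w $ i * X (t i) \<omega>)"
      using YY unfolding is_LSL_predictor_def by blast
    have "combination_scale \<alpha> m ?F (v - w) = 0"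
      using v(1) w(1) unfolding weights
      by (intro residual_scale_argmin_unique_mod_kernel[OF \<alpha>(1) F f]) auto
    then show ?thesis
      unfolding v(2) w(2)
      by (intro AE_eq[OF predictor predictor])
         (simp add: combination_scale_def left_diff_distrib sum_subtractf)
  qed

  show "AE \<omega> in P. Y \<omega> = X t0 \<omega>" if Y: "is_LSL_predictor \<alpha> m f X t t0 Y \<and> t0 = t i" for Y i
  proof -
    obtain w where w: "is_LSL_weights \<alpha> m f t t0 w" "Y = (\<lambda>\<omega>. \<Sum>i\<in>UNIV. w $ i * X (t i) \<omega>)"
      using Y unfolding is_LSL_predictor_def by blast
    \<comment> \<open>The unit vector at \<open>i\<close> predicts \<open>X (t i)\<close> without error, so the minimal scale is \<open>0\<close>.\<close>
    have "residual_scale \<alpha> m ?F (f t0) (axis i 1) = 0"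
    proof -
      have "(\<Sum>j\<in>UNIV. axis i 1 $ j * f (t j) x) = f (t i) x" for x
        by (simp add: axis_def if_distrib[of "\<lambda>a. a * _"] cong: if_cong)
      then show ?thesis using Y by (simp add: residual_scale_def stable_scale_def)
    qed
    then have "residual_scale \<alpha> m ?F (f t0) w \<le> 0" using w(1) unfolding weights by metis
    then have "residual_scale \<alpha> m ?F (f t0) w = 0" by (simp add: residual_scale_def antisym)
    then show ?thesis
      unfolding w(2) by (intro AE_eq[OF predictor X])
        (simp add: residual_scale_def stable_scale_minus_commute[of _ _ "f t0"])
  qed

  assume cont: "stochastically_continuous P X \<and> full_dimensional P \<alpha> (\<lambda>\<omega>. \<chi> i. X (t i) \<omega>)"
  fix w :: "real ^ 'd \<Rightarrow> real ^ 'n" and i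
  assume w: "\<forall>t0. is_LSL_weights \<alpha> m f t t0 (w t0)"
  have indep: "c = 0" if "combination_scale \<alpha> m ?F c = 0" for c
    using full_dimensional_imp_independent[OF X conjunct2[OF cont]] that
    unfolding combination_scale_def by blast
  have "(w \<longlongrightarrow> w s) (at s)" for s
    using w unfolding weights
    by (intro tendsto_residual_scale_argmin[OF \<alpha>(1) F f f indep
          stochastically_continuous_imp_scale_tendsto[OF X conjunct1[OF cont]]]) auto
  then show "continuous_on UNIV (\<lambda>s. w s $ i)"
    by (auto simp: continuous_on_def intro!: tendsto_vec_nth)
qed

end
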